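(* Let $\mathcal X$ and $\mathcal Y$ be sets of signed vertices of a bidirected graph $B$, and suppose that $\mathcal X$ is clean. Let $P_1,\dots,P_k$ be pairwise vertex-disjoint $\mathcal X$--$\mathcal Y$ paths in $B$, where $P_i$ starts in the vertex $v_i\in V(\mathcal X)$ for $i\in\{1,\dots,k\}$. Then precisely one of the following holds: (1) there is a set $S$ of $k$ vertices of $B$ such that $B-S$ contains no $\mathcal X$--$\mathcal Y$ path; (2) there are $k+1$ pairwise vertex-disjoint $\mathcal X$--$\mathcal Y$ paths $P_1',\dots,P_{k+1}'$ in $B$ such that $P_i'$ starts in $v_i$ for $i\in\{1,\dots,k\}$.
   Context: A bidirected graph $B=(G,\sigma)$ consists of an undirected graph $G$ without loops (parallel edges are allowed, but no two distinct edges have the same endvertices and the same signs at them) together with a signing $\sigma$ assigning to every pair $(u,e)$, where $e\in E(G)$ and $u$ is an endvertex of $e$, a sign $\sigma(u,e)\in\{+,-\}$; $V(B)=V(G)$, $E(B)=E(G)$. A signed vertex is a pair $(v,\alpha)$ with $v\in V(B)$, $\alpha\in\{+,-\}$; for a set $\mathcal X$ of signed vertices, $V(\mathcal X)$ is the set of vertices $v$ with $(v,\alpha)\in\mathcal X$ for some $\alpha$. An oriented edge is an edge together with a choice of one endvertex as startvertex and the other as endvertex. A walk of length $\ell$ is a sequence $W=v_0\vec e_1v_1\dots\vec e_\ell v_\ell$ where $\vec e_j$ is an orientation of an edge $e_j$ with startvertex $v_{j-1}$ and endvertex $v_j$, and $\sigma(v_i,e_i)\neq\sigma(v_i,e_{i+1})$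 for $1\le i\le \ell-1$. It is trivial if $\ell=0$. A nontrivial walk starts in the signed vertex $(v_0,\sigma(v_0,e_1))$ and ends in the signed vertex $(v_\ell,\sigma(v_\ell,e_\ell))$; $v_1,\dots,v_{\ell-1}$ are its internal vertices; it starts in the vertex $v_0$. A trail is a walk whose edges $e_j$ are distinct; a path is a trail all of whose vertices are distinct. Walks are vertex-disjoint if they share no vertex. $B-S$ denotes deletion of the vertex set $S$. For sets $\mathcal X,\mathcal Y$ of signed vertices: a trivial walk $v$ is an $\mathcal X$--$\mathcal Y$ walk if there is $\alpha$ with $(v,\alpha)\in\mathcal X$ and $(v,-\alpha)\in\mathcal Y$. A nontrivial walk is an $\mathcal X$--$\mathcal Y$ walk if it starts in a signed vertex of $\mathcal X$, ends in a signed vertex of $\mathcal Y$, no internal vertex lies in $V(\mathcal X)\cup V(\mathcal Y)$, and neither its startvertex nor its endvertex forms a trivial $\mathcal X$--$\mathcal Y$ walk. An $\mathcal X$--$\mathcal Y$ path is an $\mathcal X$--$\mathcal Y$ walk that is a path. The set $\mathcal X$ is clean if $B$ contains no nontrivial path that starts in a signed vertex of $\mathcal X$ and ends in a signed vertex of $\mathcal X$. *)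

theory Defs
  imports Main
begin

datatype sign = Plus | Minus

fun opposite :: "sign \<Rightarrow> sign" where
  "opposite Plus = Minus"
| "opposite Minus = Plus"

text \<open>Edges are abstract objects, so that parallel edges are possible. The values \<open>ends B e\<close> and
  \<open>signing B u e\<close> only matter when \<open>e\<close> is an edge of \<open>B\<close> and \<open>u\<close> is an endvertex of \<open>e\<close>.\<close>

record ('v, 'e) bigraph =
  verts :: "'v set"
  edges :: "'e set"
  ends :: "'e \<Rightarrow> 'v set"
  signing :: "'v \<Rightarrow> 'e \<Rightarrow> sign"

text \<open>Loops are excluded by \<open>card (ends B e) = 2\<close>. Graphs are not assumed to be finite.\<close>

locale bidirected_graph =
  fixes B :: "('v, 'e) bigraph"
  assumes ends_subset: "e \<in> edges B \<Longrightarrow> ends B e \<subseteq> verts B"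
    and card_ends: "e \<in> edges B \<Longrightarrow> card (ends B e) = 2"
    and edges_eqI: "\<lbrakk>e \<in> edges B; f \<in> edges B; ends B e = ends B f;
      \<And>u. u \<in> ends B e \<Longrightarrow> signing B u e = signing B u f\<rbrakk> \<Longrightarrow> e = f"

definition delete_verts :: "('v, 'e) bigraph \<Rightarrow> 'v set \<Rightarrow> ('v, 'e) bigraph" where
  "delete_verts B S =
    B\<lparr>verts := verts B - S, edges := {e \<in> edges B. ends B e \<inter> S = {}}\<rparr>"

definition signed_verts :: "('v, 'e) bigraph \<Rightarrow> ('v \<times> sign) set" where
  "signed_verts B = verts B \<times> UNIV"

text \<open>The pair \<open>(v\<^sub>0, [(e\<^sub>1, v\<^sub>1), \<dots>, (e\<^sub>l, v\<^sub>l)])\<close> encodes the sequence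
  \<open>v\<^sub>0 e\<^sub>1 v\<^sub>1 \<dots> e\<^sub>l v\<^sub>l\<close>. The orientation of each edge is determined by the vertices before and
  after it, as there are no loops.\<close>

type_synonym ('v, 'e) walk = "'v \<times> ('e \<times> 'v) list"

definition walk_verts :: "('v, 'e) walk \<Rightarrow> 'v list" where
  "walk_verts W = fst W # map snd (snd W)"

definition walk_edges :: "('v, 'e) walk \<Rightarrow> 'e list" where
  "walk_edges W = map fst (snd W)"

definition walk_length :: "('v, 'e) walk \<Rightarrow> nat" where
  "walk_length W = length (walk_edges W)"

definition trivial :: "('v, 'e) walk \<Rightarrow> bool" where
  "trivial W \<longleftrightarrow> walk_length W = 0"

definition start_vertex :: "('v, 'e) walk \<Rightarrow> 'v" where
  "start_vertex W = hd (walk_verts W)"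

definition end_vertex :: "('v, 'e) walk \<Rightarrow> 'v" where
  "end_vertex W = last (walk_verts W)"

text \<open>List positions are counted from 0: \<open>walk_verts W ! i\<close> is \<open>v\<^sub>i\<close>, but \<open>walk_edges W ! i\<close>
  is \<open>e\<^sub>i\<^sub>+\<^sub>1\<close>, the edge from \<open>v\<^sub>i\<close> to \<open>v\<^sub>i\<^sub>+\<^sub>1\<close>.\<close>

definition internal_verts :: "('v, 'e) walk \<Rightarrow> 'v set" where
  "internal_verts W = {walk_verts W ! i |i. 1 \<le> i \<and> i < walk_length W}"

definition is_walk :: "('v, 'e) bigraph \<Rightarrow> ('v, 'e) walk \<Rightarrow> bool" where
  "is_walk B W \<longleftrightarrow>
    set (walk_verts W) \<subseteq> verts B \<and>
    set (walk_edges W) \<subseteq> edges B \<and>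
    (\<forall>i < walk_length W. ends B (walk_edges W ! i) = {walk_verts W ! i, walk_verts W ! Suc i}) \<and>
    (\<forall>i. Suc i < walk_length W \<longrightarrow>
      signing B (walk_verts W ! Suc i) (walk_edges W ! i) \<noteq>
      signing B (walk_verts W ! Suc i) (walk_edges W ! Suc i))"

definition is_trail :: "('v, 'e) bigraph \<Rightarrow> ('v, 'e) walk \<Rightarrow> bool" where
  "is_trail B W \<longleftrightarrow> is_walk B W \<and> distinct (walk_edges W)"

definition is_path :: "('v, 'e) bigraph \<Rightarrow> ('v, 'e) walk \<Rightarrow> bool" where
  "is_path B W \<longleftrightarrow> is_trail B W \<and> distinct (walk_verts W)"

text \<open>The following two signed vertices are meaningful for nontrivial walks only.\<close>

definition start_signed :: "('v, 'e) bigraph \<Rightarrow> ('v, 'e) walk \<Rightarrow> 'v \<times> sign" where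
  "start_signed B W = (start_vertex W, signing B (start_vertex W) (hd (walk_edges W)))"

definition end_signed :: "('v, 'e) bigraph \<Rightarrow> ('v, 'e) walk \<Rightarrow> 'v \<times> sign" where
  "end_signed B W = (end_vertex W, signing B (end_vertex W) (last (walk_edges W)))"

definition vertex_disjoint :: "('v, 'e) walk \<Rightarrow> ('v, 'e) walk \<Rightarrow> bool" where
  "vertex_disjoint W W' \<longleftrightarrow> set (walk_verts W) \<inter> set (walk_verts W') = {}"

definition verts_of :: "('v \<times> sign) set \<Rightarrow> 'v set" where
  "verts_of X = {v. \<exists>\<alpha>. (v, \<alpha>) \<in> X}"

definition forms_trivial_walk :: "('v \<times> sign) set \<Rightarrow> ('v \<times> sign) set \<Rightarrow> 'v \<Rightarrow> bool" where
  "forms_trivial_walk X Y v \<longleftrightarrow> (\<exists>\<alpha>. (v, \<alpha>) \<in> X \<and> (v, opposite \<alpha>) \<in> Y)"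

text \<open>The sets \<open>X\<close> and \<open>Y\<close> may contain signed vertices outside \<open>signed_verts B\<close>; these are irrelevant
  here, so \<open>is_XY_walk (delete_verts B S) X Y\<close> is the right notion for the graph \<open>B - S\<close>.\<close>

definition is_XY_walk ::
  "('v, 'e) bigraph \<Rightarrow> ('v \<times> sign) set \<Rightarrow> ('v \<times> sign) set \<Rightarrow> ('v, 'e) walk \<Rightarrow> bool" where
  "is_XY_walk B X Y W \<longleftrightarrow> is_walk B W \<and>
    (if trivial W then forms_trivial_walk X Y (start_vertex W)
     else start_signed B W \<in> X \<and> end_signed B W \<in> Y \<and>
       internal_verts W \<inter> (verts_of X \<union> verts_of Y) = {} \<and>
       \<not> forms_trivial_walk X Y (start_vertex W) \<and>
       \<not> forms_trivial_walk X Y (end_vertex W))"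

definition is_XY_path ::
  "('v, 'e) bigraph \<Rightarrow> ('v \<times> sign) set \<Rightarrow> ('v \<times> sign) set \<Rightarrow> ('v, 'e) walk \<Rightarrow> bool" where
  "is_XY_path B X Y W \<longleftrightarrow> is_XY_walk B X Y W \<and> is_path B W"

definition clean :: "('v, 'e) bigraph \<Rightarrow> ('v \<times> sign) set \<Rightarrow> bool" where
  "clean B X \<longleftrightarrow>
    \<not> (\<exists>W. is_path B W \<and> \<not> trivial W \<and> start_signed B W \<in> X \<and> end_signed B W \<in> X)"

end

(* Write a walk as the list of its vertices together with the signs with which they are left. Bidirected
   walks then become walks in a skew-symmetric digraph on signed vertices, and X is clean iff no such
   path leads from X to the flipped copy of X.

   If X reaches some vertex with both signs, this is due to a blossom attached to a stem that starts in X
   (a "flower"). Take a flower with shortest stem. By minimality and cleanness, no path from X can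
   enter the blossom other than along the sign of the stem's end b, so contracting the blossom into b changes
   neither the disjoint paths nor the separators, and the graph gets smaller. If there is no flower,
   Goering's proof of Menger's theorem applies: for an X-Y path R that avoids the starts of the given
   paths and first meets one of them, P, in x, add the initial segments of P and R up to x to X. The
   larger set is still clean precisely because there is no flower, and P has become shorter.
   Since every separator of size k consists of vertices of the given paths, only finitely many
   sets have to be ruled out, and infinite graphs reduce to finite ones. *)

theory Submission
  imports Defs
begin

text \<open>Menger's theorem for digraphs does not apply directly: a directed path may pass a vertex
  with both signs, and two paths without common nodes may still share a vertex. Hence distinctness
  and disjointness always refer to \<open>fst\<close>. Both cases of the proof rest on one fact. If
  two paths from \<open>X\<close> pass a vertex in opposite directions, then cleanness forces a
  flower whose stem is a proper initial segment of the first path. For a flower with shortest stem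
  this forbids every path from \<open>X\<close> to arrive at \<open>flip b\<close>. Without flowers
  it says that each vertex can be reached from \<open>X\<close> with at most one sign. That the old
  starts survive is part of the induction, not an afterthought: after enlarging \<open>X\<close>,
  the new paths have to be prolonged backwards into the old \<open>X\<close>. All but two of them
  start where old paths other than \<open>P\<close> start, and the two exceptions can share out the
  two initial segments that were added to \<open>X\<close>.\<close>

definition flip :: "'v \<times> sign \<Rightarrow> 'v \<times> sign" where
  "flip n = (fst n, opposite (snd n))"

lemma opposite_opposite [simp]: "opposite (opposite a) = a"
  by (cases a) auto

lemma opposite_neq [simp]: "opposite a \<noteq> a" "a \<noteq> opposite a"
  by (cases a; simp)+

lemma eq_opposite_iff: "a = opposite b \<longleftrightarrow> a \<noteq> b"
  by (cases a; cases b) auto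

lemma flip_flip [simp]: "flip (flip n) = n"
  by (simp add: flip_def)

lemma fst_flip [simp]: "fst (flip n) = fst n"
  by (simp add: flip_def)

lemma flip_neq [simp]: "flip n \<noteq> n" "n \<noteq> flip n"
  by (auto simp: flip_def prod_eq_iff)

lemma flip_eq_iff [simp]: "flip m = flip n \<longleftrightarrow> m = n"
  by (metis flip_flip)

lemma same_fst_cases: "fst m = fst n \<Longrightarrow> m = n \<or> m = flip n"
  by (auto simp: flip_def prod_eq_iff eq_opposite_iff)

section \<open>Paths, links and linkages in a digraph on signed vertices\<close>

abbreviation vs :: "('v \<times> sign) list \<Rightarrow> 'v set" where
  "vs p \<equiv> fst ` set p"

abbreviation mirror :: "('v \<times> sign) list \<Rightarrow> ('v \<times> sign) list" where
  "mirror p \<equiv> rev (map flip p)"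

lemma vs_mirror [simp]: "vs (mirror p) = vs p"
  by (simp add: image_image)

lemma map_fst_mirror [simp]: "map fst (mirror p) = rev (map fst p)"
  by (simp add: rev_map comp_def)

abbreviation arcs :: "('a \<times> 'a) set \<Rightarrow> 'a list \<Rightarrow> bool" where
  "arcs E \<equiv> successively (\<lambda>m n. (m, n) \<in> E)"

lemma arcs_join: "arcs E (xs @ a # ys) \<longleftrightarrow> arcs E (xs @ [a]) \<and> arcs E (a # ys)"
  by (auto simp: successively_append_iff successively_Cons)

lemma arcs_into: "arcs E (xs @ a # ys) \<Longrightarrow> xs \<noteq> [] \<Longrightarrow> (last xs, a) \<in> E"
  by (auto simp: successively_append_iff)

definition rpath :: "(('v \<times> sign) \<times> ('v \<times> sign)) set \<Rightarrow> ('v \<times> sign) list \<Rightarrow> bool" where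
  "rpath E p \<longleftrightarrow> p \<noteq> [] \<and> arcs E p \<and> distinct (map fst p)"

definition link :: "(('v \<times> sign) \<times> ('v \<times> sign)) set \<Rightarrow> ('v \<times> sign) set \<Rightarrow> ('v \<times> sign) set
    \<Rightarrow> ('v \<times> sign) list \<Rightarrow> bool" where
  "link E X T p \<longleftrightarrow> rpath E p \<and> hd p \<in> X \<and> last p \<in> T"

definition linkage :: "(('v \<times> sign) \<times> ('v \<times> sign)) set \<Rightarrow> ('v \<times> sign) set \<Rightarrow> ('v \<times> sign) set
    \<Rightarrow> ('v \<times> sign) list set \<Rightarrow> bool" where
  "linkage E X T \<P> \<longleftrightarrow> finite \<P> \<and> (\<forall>p\<in>\<P>. link E X T p) \<and>
     (\<forall>p\<in>\<P>. \<forall>q\<in>\<P>. p \<noteq> q \<longrightarrow> vs p \<inter> vs q = {})"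

definition unseparated :: "(('v \<times> sign) \<times> ('v \<times> sign)) set \<Rightarrow> ('v \<times> sign) set \<Rightarrow> ('v \<times> sign) set
    \<Rightarrow> nat \<Rightarrow> bool" where
  \<comment> \<open>\<open>S\<close> ranges over all finite sets, not only over vertices of the
    digraph, so the notion is inherited when vertices are contracted. Finiteness matters for
    \<open>k = 0\<close>, because infinite sets have \<open>card\<close> 0.\<close>
  "unseparated E X T k \<longleftrightarrow> (\<forall>S. finite S \<and> card S = k \<longrightarrow> (\<exists>p. link E X T p \<and> vs p \<inter> S = {}))"

lemma linkage_image:
  assumes "finite \<P>" and f: "\<And>p. p \<in> \<P> \<Longrightarrow> link E X T (f p)"
    and disj: "\<And>p q. p \<in> \<P> \<Longrightarrow> q \<in> \<P> \<Longrightarrow> p \<noteq> q \<Longrightarrow> vs (f p) \<inter> vs (f q) = {}"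
  shows "linkage E X T (f ` \<P>)" "card (f ` \<P>) = card \<P>"
proof -
  show "linkage E X T (f ` \<P>)"
    using assms unfolding linkage_def by (metis (no_types, lifting) finite_imageI imageE)
  have "inj_on f \<P>"
  proof (rule inj_onI, rule ccontr)
    fix p q assume "p \<in> \<P>" "q \<in> \<P>" "f p = f q" "p \<noteq> q"
    then show False using disj[of p q] f[of q] by (simp add: link_def rpath_def)
  qed
  then show "card (f ` \<P>) = card \<P>" by (rule card_image)
qed

lemma linkage_inj_hd: "linkage E X T \<P> \<Longrightarrow> inj_on hd \<P>"
proof (rule inj_onI, rule ccontr)
  fix p q assume "linkage E X T \<P>" "p \<in> \<P>" "q \<in> \<P>" "hd p = hd q" "p \<noteq> q"
  moreover from this have "hd p \<in> set p" "hd q \<in> set q"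
    by (metis hd_in_set linkage_def link_def rpath_def)+
  ultimately show False unfolding linkage_def by (metis IntI empty_iff imageI)
qed

lemma disjoint_subsets: "A \<inter> B = {} \<Longrightarrow> A' \<subseteq> A \<Longrightarrow> B' \<subseteq> B \<Longrightarrow> A' \<inter> B' = {}"
  by blast

lemma disjoint_with_extra:
  "A \<subseteq> P \<and> B \<subseteq> Q \<union> C \<or> A \<subseteq> P \<union> C \<and> B \<subseteq> Q \<Longrightarrow> P \<inter> Q = {} \<Longrightarrow> P \<inter> C = {} \<Longrightarrow> Q \<inter> C = {}
    \<Longrightarrow> A \<inter> B = {}"
  by blast

lemma distinct_insertion:
  assumes "distinct (map fst (xs @ ys))" "distinct (map fst zs)" "vs zs \<subseteq> A" "vs (xs @ ys) \<inter> A = {}"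
  shows "distinct (map fst (xs @ zs @ ys))"
proof -
  have "vs zs \<inter> vs (xs @ ys) = {}" using assms(3,4) by blast
  then show ?thesis using assms(1,2) by (simp add: image_Un Int_commute Int_Un_distrib2 Int_Un_distrib)
qed

text \<open>The vertices of a flower with stem \<open>as\<close> and base \<open>x\<close>: along an
  ear \<open>ds\<close> to \<open>y\<close>, then back along the segment \<open>bs\<close>.\<close>

lemma distinct_detour:
  "distinct (as @ x # bs @ y # cs) \<Longrightarrow> distinct ds \<Longrightarrow> set ds \<inter> set (as @ x # bs @ y # cs) = {}
    \<Longrightarrow> distinct (as @ x # ds @ y # rev bs)"
  by auto

section \<open>Skew-symmetric digraphs with a clean source set\<close>

locale clean_skew =
  fixes E :: "(('v \<times> sign) \<times> ('v \<times> sign)) set" and X :: "('v \<times> sign) set"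
  assumes skew: "(m, n) \<in> E \<Longrightarrow> (flip n, flip m) \<in> E"
    and into_X: "(m, n) \<in> E \<Longrightarrow> n \<notin> X"
    and clean_X: "rpath E p \<Longrightarrow> hd p \<in> X \<Longrightarrow> flip (last p) \<notin> X"
begin

lemma arcs_mirror: "arcs E p \<Longrightarrow> arcs E (mirror p)"
  unfolding successively_rev successively_map
  by (erule successively_mono) (auto intro: skew)

lemma clean_prefix: "rpath E (p @ n # q) \<Longrightarrow> hd (p @ [n]) \<in> X \<Longrightarrow> flip n \<notin> X"
  using clean_X[of "p @ [n]"] by (auto simp: rpath_def arcs_join[of E p n q])

text \<open>\<open>N @ [b]\<close> is a stem from \<open>X\<close> to \<open>b\<close>, and \<open>b # c @ [flip b]\<close> is a blossom, left and re-entered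
  at \<open>b\<close> with the same sign.\<close>

definition flower :: "('v \<times> sign) list \<Rightarrow> 'v \<times> sign \<Rightarrow> ('v \<times> sign) list \<Rightarrow> bool" where
  "flower N b c \<longleftrightarrow> arcs E (N @ [b]) \<and> arcs E (b # c @ [flip b]) \<and> c \<noteq> [] \<and>
     distinct (map fst (N @ b # c)) \<and> hd (N @ [b]) \<in> X"

text \<open>Follow \<open>Z\<close> to the first node \<open>z\<close> that runs against
  \<open>N\<close>. If \<open>Z\<close> has not met \<open>N\<close> before, it can continue
  backwards along \<open>N\<close> to the start of \<open>N\<close>, which cleanness forbids.
  Otherwise the part of \<open>Z\<close> since its last meeting \<open>y\<close> with
  \<open>N\<close> is an ear; with the segment of \<open>N\<close> between \<open>y\<close> and
  \<open>n\<close> it forms a blossom at whichever of the two comes first on \<open>N\<close>. The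
  length bound says that the stem \<open>N' @ [b]\<close> is strictly shorter than
  \<open>N\<close>.\<close>

lemma flower_if_wrong_way:
  assumes N: "rpath E N" "hd N \<in> X" and Z: "rpath E Z" "hd Z \<in> X"
    and wrong: "n0 \<in> set N" "flip n0 \<in> set Z"
  obtains N' b c where "flower N' b c" "Suc (length N') < length N"
proof -
  have "\<exists>z\<in>set Z. flip z \<in> set N"
    using wrong by (intro bexI[of _ "flip n0"]) auto
  then obtain Z1 z Z2 where Z_eq: "Z = Z1 @ z # Z2" and z: "flip z \<in> set N"
    and Z1: "\<forall>y\<in>set Z1. flip y \<notin> set N"
    using split_list_first_prop[of Z "\<lambda>z. flip z \<in> set N"] by blast
  define n where "n = flip z"
  have zn: "z = flip n" and n: "n \<in> set N"
    using z by (auto simp: n_def)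
  have Zarcs: "arcs E (Z1 @ [flip n])" and Zdist: "distinct (map fst (Z1 @ [flip n]))"
    and Zhd: "hd (Z1 @ [flip n]) \<in> X"
    using Z unfolding rpath_def Z_eq zn arcs_join[of E Z1 _ Z2] by (auto simp: hd_append split: if_splits)
  show thesis
  proof (cases "\<exists>y\<in>set Z1. fst y \<in> vs N")
    case False
    then have disj: "vs Z1 \<inter> vs N = {}"
      by auto
    obtain A C where N_eq: "N = A @ n # C"
      using n by (meson split_list)
    have "arcs E (mirror (A @ [n]))"
      using N(1) by (intro arcs_mirror) (simp add: rpath_def N_eq arcs_join[of E A n C])
    then have "arcs E (Z1 @ flip n # mirror A)"
      using Zarcs by (subst arcs_join) simp
    moreover have "distinct (map fst (Z1 @ flip n # mirror A))"
      using Zdist N(1) disj unfolding rpath_def N_eq by (simp add: image_image) blast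
    ultimately have "rpath E (Z1 @ flip n # mirror A)"
      by (simp add: rpath_def)
    moreover have "hd (Z1 @ flip n # mirror A) \<in> X"
      using Zhd by (cases Z1) auto
    moreover have "last (Z1 @ flip n # mirror A) = flip (hd N)"
      by (cases A) (auto simp: N_eq)
    ultimately show ?thesis
      using clean_X N(2) by fastforce
  next
    case True
    then obtain Z11 y Z12 where Z1_eq: "Z1 = Z11 @ y # Z12" and y: "fst y \<in> vs N"
      and Z12: "\<forall>w\<in>set Z12. fst w \<notin> vs N"
      using split_list_last_prop[of Z1 "\<lambda>y. fst y \<in> vs N"] by blast
    then have disj: "vs Z12 \<inter> vs N = {}"
      by auto
    from y obtain n' where "n' \<in> set N" "fst y = fst n'" by auto
    \<comment> \<open>Before \<open>z\<close> no node of \<open>Z\<close> runs against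
      \<open>N\<close>, so \<open>y\<close> is passed by both paths in the same direction.\<close>
    moreover have "flip y \<notin> set N" using Z1 Z1_eq by auto
    ultimately have yN: "y \<in> set N"
      using same_fst_cases[of y n'] by auto
    have "y \<noteq> n" using Zdist Z1_eq by auto
    have ear: "arcs E (y # Z12 @ [flip n])"
      using Zarcs Z1_eq arcs_join[of E Z11 y "Z12 @ [flip n]"] by simp
    have ear': "arcs E (n # mirror Z12 @ [flip y])"
      using arcs_mirror[OF ear] by simp
    have dist: "distinct (map fst Z12)" "fst y \<notin> vs Z12" "fst n \<notin> vs Z12"
      using Zdist Z1_eq by auto
    obtain A C where N_eq: "N = A @ n # C"
      using n by (meson split_list)
    then consider "y \<in> set A" | "y \<in> set C"
      using yN \<open>y \<noteq> n\<close> by auto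
    then show ?thesis
    proof cases
      \<comment> \<open>Base \<open>y\<close>: along the ear to \<open>flip n\<close>, then back
        along the segment of \<open>N\<close> from \<open>y\<close> to \<open>n\<close>.\<close>
      case 1
      then obtain A1 M where A_eq: "A = A1 @ y # M"
        by (meson split_list)
      have NE: "N = A1 @ y # M @ n # C"
        using N_eq A_eq by simp
      have a: "arcs E (A1 @ [y])" "arcs E (y # M @ [n])"
        using N(1) arcs_join[of E A1 y "M @ n # C"] arcs_join[of E "y # M" n C]
        by (auto simp: rpath_def NE)
      have "arcs E (flip n # mirror M @ [flip y])"
        using arcs_mirror[OF a(2)] by simp
      then have "arcs E (y # (Z12 @ flip n # mirror M) @ [flip y])"
        using ear arcs_join[of E "y # Z12" "flip n" "mirror M @ [flip y]"] by simp
      moreover have "distinct (map fst (A1 @ y # Z12 @ flip n # mirror M))"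
        using N(1) dist disj distinct_detour[of "map fst A1" "fst y" "map fst M" "fst n" "map fst C" "map fst Z12"]
        by (simp add: rpath_def NE image_image image_Un)
      moreover have "hd (A1 @ [y]) \<in> X"
        using N(2) NE by (cases A1) auto
      ultimately have "flower A1 y (Z12 @ flip n # mirror M)"
        using a by (simp add: flower_def)
      then show ?thesis
        using that NE by fastforce
    next
      \<comment> \<open>Base \<open>n\<close>: now the ear itself is run through backwards, from
        \<open>n\<close> to \<open>flip y\<close>.\<close>
      case 2
      then obtain M C1 where C_eq: "C = M @ y # C1"
        by (meson split_list)
      have NE: "N = A @ n # M @ y # C1"
        using N_eq C_eq by simp
      have a: "arcs E (A @ [n])" "arcs E (n # M @ [y])"
        using N(1) arcs_join[of E A n "M @ y # C1"] arcs_join[of E "n # M" y C1]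
        by (auto simp: rpath_def NE)
      have "arcs E (flip y # mirror M @ [flip n])"
        using arcs_mirror[OF a(2)] by simp
      then have "arcs E (n # (mirror Z12 @ flip y # mirror M) @ [flip n])"
        using ear' arcs_join[of E "n # mirror Z12" "flip y" "mirror M @ [flip n]"] by simp
      moreover have "distinct (map fst (A @ n # mirror Z12 @ flip y # mirror M))"
        using N(1) dist disj distinct_detour[of "map fst A" "fst n" "map fst M" "fst y" "map fst C1" "rev (map fst Z12)"]
        by (simp add: rpath_def NE image_image image_Un)
      moreover have "hd (A @ [n]) \<in> X"
        using N(2) NE by (cases A) auto
      ultimately have "flower A n (mirror Z12 @ flip y # mirror M)"
        using a by (simp add: flower_def)
      then show ?thesis
        using that NE by fastforce
    qed
  qed
qed

end

section \<open>Contraction of a blossom with shortest stem\<close>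

locale contraction = clean_skew E X
  for E :: "(('v \<times> sign) \<times> ('v \<times> sign)) set" and X +
  fixes N :: "('v \<times> sign) list" and b :: "'v \<times> sign" and c :: "('v \<times> sign) list"
    and T :: "('v \<times> sign) set"
  assumes flower_Nbc: "flower N b c"
    and minimal: "flower N' b' c' \<Longrightarrow> length N \<le> length N'"
begin

definition C :: "'v set" where
  "C = vs c"

definition K :: "('v \<times> sign) set" where
  "K = set c \<union> flip ` set c"

text \<open>Arcs from the blossom back to the vertex of \<open>b\<close> are left out, since they
  would turn into loops.\<close>

definition exits :: "('v \<times> sign) set" where
  "exits = {n. \<exists>k\<in>K. (k, n) \<in> E \<and> fst n \<notin> insert (fst b) C}"

text \<open>The contraction keeps \<open>b\<close> and deletes the other vertices of the blossom; all of these can be left with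
  either sign after entering the blossom through \<open>b\<close>, hence the arcs from \<open>b\<close> to \<open>exits\<close>.\<close>

definition E' :: "(('v \<times> sign) \<times> ('v \<times> sign)) set" where
  "E' = {(m, n) \<in> E. fst m \<notin> C \<and> fst n \<notin> C} \<union> {b} \<times> exits \<union> (flip ` exits) \<times> {flip b}"

text \<open>Ending at \<open>b\<close> stands for entering the blossom and stopping at a target
  inside it.\<close>

definition T' :: "('v \<times> sign) set" where
  "T' = {t \<in> T. fst t \<notin> C} \<union> (if K \<inter> T = {} then {} else {b})"

lemma flip_K: "k \<in> K \<Longrightarrow> flip k \<in> K"
  by (auto simp: K_def)

lemma in_K_iff: "k \<in> K \<longleftrightarrow> fst k \<in> C"
proof
  assume "fst k \<in> C"
  then obtain k' where "k' \<in> set c" "fst k = fst k'" by (auto simp: C_def)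
  then show "k \<in> K"
    using same_fst_cases[of k k'] by (auto simp: K_def)
qed (force simp: K_def C_def)

lemma b_notin_C: "fst b \<notin> C"
  using flower_Nbc by (auto simp: flower_def C_def)

lemma stem_path: "rpath E (N @ [b])" "hd (N @ [b]) \<in> X"
  using flower_Nbc by (auto simp: flower_def rpath_def)

text \<open>The blossom can be run through along \<open>c\<close> or along its mirror image, and
  each node of \<open>K\<close> lies on one of the two.\<close>

lemma detour:
  assumes "k \<in> K"
  obtains l where "arcs E (b # l @ [k])" "distinct (map fst (l @ [k]))" "vs (l @ [k]) \<subseteq> C"
proof -
  have *: "\<exists>l. arcs E (b # l @ [k]) \<and> distinct (map fst (l @ [k])) \<and> vs (l @ [k]) \<subseteq> C"
    if c': "arcs E (b # c' @ [flip b])" "distinct (map fst c')" "vs c' = C" "k \<in> set c'" for c'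
  proof -
    obtain l l' where l: "c' = l @ k # l'"
      using c'(4) by (meson split_list)
    have "arcs E (b # l @ [k])"
      using c'(1) arcs_join[of E "b # l" k "l' @ [flip b]"] by (simp add: l)
    then show ?thesis
      using c'(2,3) by (intro exI[of _ l]) (auto simp: l)
  qed
  have c: "arcs E (b # c @ [flip b])" "distinct (map fst c)"
    using flower_Nbc by (auto simp: flower_def)
  consider "k \<in> set c" | "k \<in> set (mirror c)"
    using assms by (auto simp: K_def)
  then show ?thesis
  proof cases
    case 1
    then show ?thesis using c *[of c] that unfolding C_def by blast
  next
    case 2
    have "arcs E (b # mirror c @ [flip b])"
      using arcs_mirror[OF c(1)] by simp
    moreover have "distinct (map fst (mirror c))"
      using c(2) unfolding map_fst_mirror by simp
    ultimately show ?thesis using 2 *[of "mirror c"] that unfolding C_def vs_mirror by blast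
  qed
qed

lemma detour_back:
  assumes "k \<in> K"
  obtains l where "arcs E (k # l @ [flip b])" "distinct (map fst (k # l))" "vs (k # l) \<subseteq> C"
proof -
  obtain l where l: "arcs E (b # l @ [flip k])" "distinct (map fst (l @ [flip k]))" "vs (l @ [flip k]) \<subseteq> C"
    using detour flip_K[OF assms] by blast
  have "arcs E (k # mirror l @ [flip b])"
    using arcs_mirror[OF l(1)] by simp
  moreover have "distinct (map fst (k # mirror l))"
    using l(2) unfolding list.map map_fst_mirror by auto
  moreover have "vs (k # mirror l) \<subseteq> C"
    using l(3) by (auto simp: image_image)
  ultimately show ?thesis using that by blast
qed

text \<open>The stem and a detour would lead to \<open>flip x\<close>, against cleanness.\<close>

lemma X_notin_C: "x \<in> X \<Longrightarrow> fst x \<notin> C"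
proof
  assume x: "x \<in> X" "fst x \<in> C"
  then have "flip x \<in> K" by (simp add: in_K_iff)
  then obtain l where l: "arcs E (b # l @ [flip x])" "distinct (map fst (l @ [flip x]))" "vs (l @ [flip x]) \<subseteq> C"
    using detour by blast
  have "rpath E (N @ b # l @ [flip x])"
    using flower_Nbc l(1) arcs_join[of E N b "l @ [flip x]"] distinct_insertion[of "N @ [b]" "[]", OF _ l(2,3)]
    by (simp add: rpath_def flower_def C_def image_Un Int_Un_distrib2)
  then show False
    using clean_X[of "N @ b # l @ [flip x]"] stem_path(2) x(1) by (cases N) auto
qed

lemma flip_b_notin_X: "flip b \<notin> X"
  using clean_X[OF stem_path] by simp

text \<open>Here minimality enters: such a path runs against the stem at its last node
  \<open>b\<close>, which yields a flower with a shorter stem.\<close>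

lemma no_wrong_entry: "rpath E Z \<Longrightarrow> hd Z \<in> X \<Longrightarrow> flip b \<notin> set Z"
proof
  assume "rpath E Z" "hd Z \<in> X" "flip b \<in> set Z"
  then obtain N' b' c' where "flower N' b' c'" "Suc (length N') < length (N @ [b])"
    using flower_if_wrong_way[OF stem_path, of Z b] by (metis last_in_set last_snoc snoc_eq_iff_butlast)
  then show False using minimal by fastforce
qed

text \<open>A path that first meets the blossom at a vertex other than that of \<open>b\<close>
  could go on around the blossom to \<open>flip b\<close>.\<close>

lemma no_side_entry:
  assumes "rpath E (Z0 @ k # Z1)" "hd (Z0 @ [k]) \<in> X" "vs Z0 \<inter> insert (fst b) C = {}"
  shows "k \<notin> K"
proof
  assume "k \<in> K"
  then obtain l where l: "arcs E (k # l @ [flip b])" "distinct (map fst (k # l))" "vs (k # l) \<subseteq> C"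
    using detour_back by blast
  have "rpath E (Z0 @ k # l @ [flip b])"
    using assms l(1) b_notin_C arcs_join[of E Z0 k Z1] arcs_join[of E Z0 k "l @ [flip b]"]
      distinct_insertion[of Z0 "[flip b]", OF _ l(2,3)]
    by (simp add: rpath_def image_Un Int_Un_distrib2)
  then show False
    using no_wrong_entry[of "Z0 @ k # l @ [flip b]"] assms(2) by (cases Z0) auto
qed

lemma E'_fst: "(m, n) \<in> E' \<Longrightarrow> fst m \<notin> C \<and> fst n \<notin> C"
  using b_notin_C by (auto simp: E'_def exits_def)

lemma arcs_restrict: "arcs E p \<Longrightarrow> vs p \<inter> C = {} \<Longrightarrow> arcs E' p"
  by (induction p rule: induct_list012) (auto simp: E'_def)

text \<open>All new arcs leave \<open>b\<close> or enter \<open>flip b\<close>.\<close>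

lemma arcs_old: "arcs E' p \<Longrightarrow> b \<notin> set (butlast p) \<Longrightarrow> flip b \<notin> set (tl p) \<Longrightarrow> arcs E p"
  by (induction p rule: induct_list012) (auto simp: E'_def)

lemma arcs_old_avoid: "arcs E' p \<Longrightarrow> b \<notin> set p \<Longrightarrow> flip b \<notin> set p \<Longrightarrow> arcs E p"
  by (rule arcs_old) (auto dest: in_set_butlastD, cases p, auto)

lemma arcs_old_snoc: "arcs E' (p @ [b]) \<Longrightarrow> b \<notin> set p \<Longrightarrow> flip b \<notin> set p \<Longrightarrow> arcs E (p @ [b])"
  by (rule arcs_old) (auto, cases p, auto)

lemma arcs_old_Cons: "arcs E' (flip b # p) \<Longrightarrow> b \<notin> set p \<Longrightarrow> flip b \<notin> set p \<Longrightarrow> arcs E (flip b # p)"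
  by (rule arcs_old) (auto dest: in_set_butlastD)

lemma arcs_E'_notin_C: "arcs E' p \<Longrightarrow> p \<noteq> [] \<Longrightarrow> fst (hd p) \<notin> C \<Longrightarrow> vs p \<inter> C = {}"
  by (induction p rule: induct_list012) (auto dest: E'_fst)

text \<open>By the two entry lemmas, a path that meets \<open>C\<close> enters the blossom through
  \<open>b\<close>. Everything between \<open>b\<close> and its last node \<open>k\<close> in
  \<open>C\<close> can be skipped, because the successor of \<open>k\<close> is an exit; if
  \<open>k\<close> is the last node, the path may stop at \<open>b\<close> by the choice of
  \<open>T'\<close>.\<close>

lemma project:
  assumes "link E X T Z"
  obtains q where "link E' X T' q" "hd q = hd Z" "vs q \<subseteq> vs Z"
proof (cases "vs Z \<inter> C = {}")
  case True
  moreover have "last Z \<in> set Z"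
    using assms by (simp add: link_def rpath_def)
  ultimately have "last Z \<in> T'"
    using assms by (auto simp: T'_def link_def)
  then show ?thesis
    using assms True that[of Z] arcs_restrict by (auto simp: link_def rpath_def)
next
  case False
  then have "\<exists>z\<in>set Z. fst z \<in> insert (fst b) C" by auto
  then obtain Z0 q Z1 where Z: "Z = Z0 @ q # Z1" and q: "fst q \<in> insert (fst b) C"
    and Z0: "\<forall>z\<in>set Z0. fst z \<notin> insert (fst b) C"
    using split_list_first_prop[of Z "\<lambda>z. fst z \<in> insert (fst b) C"] by blast
  have Zp: "rpath E Z" "hd Z \<in> X" "last Z \<in> T" using assms by (auto simp: link_def)
  have "hd (Z0 @ [q]) \<in> X" using Zp Z by (cases Z0) auto
  then have "q \<notin> K"
    using Zp Z Z0 by (intro no_side_entry[of Z0 q Z1]) auto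
  then have "fst q = fst b" using q by (auto simp: in_K_iff)
  then have qb: "q = b"
    using same_fst_cases[of q b] no_wrong_entry[OF Zp(1,2)] Z by auto
  have "\<exists>z\<in>set Z1. fst z \<in> C" using False Z0 b_notin_C by (auto simp: Z qb)
  then obtain Z2 k Z3 where Z1: "Z1 = Z2 @ k # Z3" and k: "fst k \<in> C"
    and Z3: "\<forall>z\<in>set Z3. fst z \<notin> C"
    using split_list_last_prop[of Z1 "\<lambda>z. fst z \<in> C"] by blast
  have "k \<in> K" using k by (simp add: in_K_iff)
  have "arcs E' (Z0 @ [b])"
    using Zp(1) Z0 b_notin_C arcs_join[of E Z0 b Z1] by (intro arcs_restrict) (auto simp: rpath_def Z qb)
  moreover have "arcs E' (b # Z3)"
  proof (cases Z3)
    case (Cons n Z4)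
    have "arcs E (k # Z3)"
      using Zp(1) arcs_join[of E "Z0 @ b # Z2" k Z3] by (simp add: rpath_def Z qb Z1)
    then have "(k, n) \<in> E" "arcs E Z3"
      by (auto simp: Cons)
    moreover from this have "arcs E' Z3"
      using Z3 by (intro arcs_restrict) auto
    moreover have "fst n \<noteq> fst b" "fst n \<notin> C"
      using Zp(1) Z3 Cons by (auto simp: rpath_def Z Z1 qb)
    ultimately have "n \<in> exits" using \<open>k \<in> K\<close> by (auto simp: exits_def)
    then have "(b, n) \<in> E'" by (simp add: E'_def)
    then show ?thesis using \<open>arcs E' Z3\<close> Cons by simp
  qed simp
  ultimately have "arcs E' (Z0 @ b # Z3)" using arcs_join[of E' Z0 b Z3] by blast
  then have "rpath E' (Z0 @ b # Z3)"
    using Zp(1) by (auto simp: rpath_def Z Z1 qb)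
  moreover have "hd (Z0 @ b # Z3) = hd Z"
    by (cases Z0) (auto simp: Z qb)
  moreover have "last (Z0 @ b # Z3) \<in> T'"
  proof (cases "Z3 = []")
    case True
    then have "k \<in> T" using Zp(3) by (simp add: Z Z1)
    then show ?thesis using True \<open>k \<in> K\<close> by (auto simp: T'_def)
  next
    case False
    then have "last (Z0 @ b # Z3) = last Z" "last Z3 = last Z" by (auto simp: Z Z1)
    moreover have "fst (last Z3) \<notin> C" using Z3 False by auto
    ultimately show ?thesis using Zp(3) by (auto simp: T'_def)
  qed
  ultimately have "link E' X T' (Z0 @ b # Z3)" "hd (Z0 @ b # Z3) = hd Z"
    using Zp(2) by (auto simp: link_def)
  moreover have "vs (Z0 @ b # Z3) \<subseteq> vs Z" by (auto simp: Z Z1 qb)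
  ultimately show ?thesis using that by blast
qed

text \<open>The vertex of \<open>b\<close> is visited at most once, so at most one new arc is used,
  and a detour through the blossom replaces it. The last conclusion says that only a path through
  the vertex of \<open>b\<close> acquires vertices of \<open>C\<close>.\<close>

lemma lift_arcs:
  assumes q: "rpath E' q" and qC: "vs q \<inter> C = {}"
  obtains p where "rpath E p" "hd p = hd q" "last p = last q" "vs p \<subseteq> vs q \<union> C"
    "fst b \<notin> vs q \<Longrightarrow> vs p \<subseteq> vs q"
proof (cases "arcs E q")
  case True
  then show ?thesis using q that[of q] by (auto simp: rpath_def)
next
  case False
  have aq: "arcs E' q" and dq: "distinct (map fst q)"
    using q by (auto simp: rpath_def)
  consider "fst b \<notin> vs q" | "b \<in> set q" | "flip b \<in> set q"
    using same_fst_cases[of _ b] by (metis (no_types, lifting) imageE)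
  then show ?thesis
  proof cases
    case 1
    then have "b \<notin> set q" "flip b \<notin> set q"
      by (metis imageI, metis imageI fst_flip)
    then have "arcs E q"
      using aq by (intro arcs_old_avoid)
    then show ?thesis using False by simp
  next
    case 2
    then obtain q1 q2 where q_eq: "q = q1 @ b # q2"
      by (meson split_list)
    have nb: "b \<notin> set q1 \<union> set q2" "flip b \<notin> set q1 \<union> set q2"
      using dq by (auto simp: q_eq rev_image_eqI)
    have a1: "arcs E (q1 @ [b])"
      using aq nb arcs_join[of E' q1 b q2] by (intro arcs_old_snoc) (auto simp: q_eq)
    have a2: "arcs E q2"
      using aq nb by (intro arcs_old_avoid) (auto simp: q_eq successively_append_iff successively_Cons)
    have ne: "q2 \<noteq> []" and nE: "(b, hd q2) \<notin> E"
      using False a1 a2 arcs_join[of E q1 b q2] by (auto simp: q_eq successively_Cons)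
    have "(b, hd q2) \<in> E'"
      using aq ne by (auto simp: q_eq successively_append_iff successively_Cons)
    moreover have "hd q2 \<noteq> flip b" using nb(2) ne by (metis UnCI hd_in_set)
    ultimately have "hd q2 \<in> exits" using nE by (auto simp: E'_def)
    then obtain k where k: "k \<in> K" "(k, hd q2) \<in> E" by (auto simp: exits_def)
    obtain l where l: "arcs E (b # l @ [k])" "distinct (map fst (l @ [k]))" "vs (l @ [k]) \<subseteq> C"
      using detour k by blast
    have "arcs E (k # q2)" using k(2) a2 ne by (cases q2) auto
    then have "arcs E (q1 @ b # l @ k # q2)"
      using a1 l(1) arcs_join[of E "b # l" k q2] arcs_join[of E q1 b "l @ k # q2"] by simp
    moreover have "distinct (map fst (q1 @ b # l @ k # q2))"
      using distinct_insertion[of "q1 @ [b]" q2 "l @ [k]", OF _ l(2,3)] dq qC by (simp add: q_eq)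
    moreover have "hd (q1 @ b # l @ k # q2) = hd q" by (cases q1) (auto simp: q_eq)
    moreover have "last (q1 @ b # l @ k # q2) = last q" using ne by (auto simp: q_eq)
    ultimately show ?thesis
      using that[of "q1 @ b # l @ k # q2"] l(3) by (auto simp: rpath_def q_eq)
  next
    case 3
    then obtain q1 q2 where q_eq: "q = q1 @ flip b # q2"
      by (meson split_list)
    have nb: "b \<notin> set q1 \<union> set q2" "flip b \<notin> set q1 \<union> set q2"
      using dq by (auto simp: q_eq rev_image_eqI)
    have a1: "arcs E q1"
      using aq nb by (intro arcs_old_avoid) (auto simp: q_eq successively_append_iff successively_Cons)
    have a2: "arcs E (flip b # q2)"
      using aq nb by (intro arcs_old_Cons) (auto simp: q_eq successively_append_iff)
    have ne: "q1 \<noteq> []" and nE: "(last q1, flip b) \<notin> E"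
      using False a1 a2 by (auto simp: q_eq successively_append_iff)
    have "(last q1, flip b) \<in> E'"
      using aq ne by (auto simp: q_eq successively_append_iff)
    moreover have "last q1 \<noteq> b" using nb(1) ne by (metis UnCI last_in_set)
    \<comment> \<open>The arc into \<open>flip b\<close> is the reversal of an arc from
      \<open>b\<close> to an exit, so by skew symmetry \<open>last q1\<close> has an arc into the
      blossom.\<close>
    ultimately have "flip (last q1) \<in> exits" using nE by (auto simp: E'_def)
    then obtain k where k: "k \<in> K" "(k, flip (last q1)) \<in> E" by (auto simp: exits_def)
    then have k': "flip k \<in> K" "(last q1, flip k) \<in> E" using skew[OF k(2)] flip_K by auto
    obtain l where l: "arcs E (flip k # l @ [flip b])" "distinct (map fst (flip k # l))" "vs (flip k # l) \<subseteq> C"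
      using detour_back k' by blast
    have "arcs E (flip k # l @ flip b # q2)"
      using l(1) a2 arcs_join[of E "flip k # l" "flip b" q2] by simp
    then have "arcs E (q1 @ flip k # l @ flip b # q2)"
      using a1 k'(2) by (auto simp: successively_append_iff[of _ q1])
    moreover have "distinct (map fst (q1 @ flip k # l @ flip b # q2))"
      using distinct_insertion[of q1 "flip b # q2" "flip k # l", OF _ l(2,3)] dq qC by (simp add: q_eq)
    moreover have "hd (q1 @ flip k # l @ flip b # q2) = hd q" using ne by (auto simp: q_eq)
    moreover have "last (q1 @ flip k # l @ flip b # q2) = last q" by (auto simp: q_eq)
    ultimately show ?thesis
      using that[of "q1 @ flip k # l @ flip b # q2"] l(3) by (auto simp: rpath_def q_eq)
  qed
qed

lemma link_E'_notin_C: "rpath E' q \<Longrightarrow> hd q \<in> X \<Longrightarrow> vs q \<inter> C = {}"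
  using arcs_E'_notin_C[of q] X_notin_C by (auto simp: rpath_def)

lemma lift:
  assumes "link E' X T' q"
  obtains p where "link E X T p" "hd p = hd q" "vs p \<subseteq> vs q \<union> C" "fst b \<notin> vs q \<Longrightarrow> vs p \<subseteq> vs q"
proof -
  have q: "rpath E' q" "hd q \<in> X" "last q \<in> T'" and qC: "vs q \<inter> C = {}"
    using assms link_E'_notin_C[of q] by (auto simp: link_def)
  show ?thesis
  proof (cases "last q \<in> T")
    case True
    then show ?thesis
      using lift_arcs[OF q(1) qC] that q(2) unfolding link_def by metis
  next
    case False
    then obtain k where k: "k \<in> K" "k \<in> T" and lq: "last q = b"
      using q(3) by (auto simp: T'_def split: if_splits)
    obtain q1 where q_eq: "q = q1 @ [b]"
      using q(1) lq by (metis append_butlast_last_id rpath_def)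
    have nb: "b \<notin> set q1" "flip b \<notin> set q1"
      using q(1) by (auto simp: q_eq rpath_def rev_image_eqI)
    have a1: "arcs E q"
      using q(1) nb unfolding q_eq by (intro arcs_old_snoc) (auto simp: rpath_def)
    obtain l where l: "arcs E (b # l @ [k])" "distinct (map fst (l @ [k]))" "vs (l @ [k]) \<subseteq> C"
      using detour k by blast
    have "arcs E (q1 @ b # l @ [k])"
      using a1 l(1) arcs_join[of E q1 b "l @ [k]"] by (simp add: q_eq)
    moreover have "distinct (map fst (q1 @ b # l @ [k]))"
      using distinct_insertion[of "q1 @ [b]" "[]" "l @ [k]", OF _ l(2,3)] q(1) qC
      by (simp add: q_eq rpath_def)
    moreover have "hd (q1 @ b # l @ [k]) = hd q" by (cases q1) (auto simp: q_eq)
    ultimately show ?thesis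
      using that[of "q1 @ b # l @ [k]"] l(3) k(2) q(2) by (auto simp: link_def rpath_def q_eq)
  qed
qed

text \<open>Cleanness is inherited because lifting keeps both ends of a path.\<close>

lemma clean_skew_E': "clean_skew E' X"
proof
  show "(flip n, flip m) \<in> E'" if "(m, n) \<in> E'" for m n
    using that by (auto simp: E'_def intro: skew)
  show "n \<notin> X" if "(m, n) \<in> E'" for m n
    using that flip_b_notin_X by (auto simp: E'_def exits_def dest: into_X)
  show "flip (last p) \<notin> X" if "rpath E' p" "hd p \<in> X" for p
    using lift_arcs[OF that(1) link_E'_notin_C[OF that]] clean_X that(2) by metis
qed

lemma E'_subset: "E' \<subseteq> Field E \<times> Field E"
proof -
  have "(b, hd c) \<in> E"
    using flower_Nbc by (cases c) (auto simp: flower_def)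
  then have "b \<in> Field E" "flip b \<in> Field E"
    by (auto intro: FieldI1 FieldI2 skew)
  moreover have "n \<in> Field E" "flip n \<in> Field E" if "n \<in> exits" for n
    using that by (auto simp: exits_def intro: FieldI1 FieldI2 skew)
  ultimately show ?thesis
    by (auto simp: E'_def intro: FieldI1 FieldI2)
qed

text \<open>The vertices of \<open>C\<close> disappear, and \<open>c \<noteq> []\<close> guarantees
  that there is one.\<close>

lemma card_E':
  assumes "finite E"
  shows "finite E'" "card (fst ` Field E') < card (fst ` Field E)"
proof -
  show "finite E'"
    using E'_subset assms finite_Field finite_subset by blast
  have "fst ` Field E' \<subseteq> fst ` Field E - C"
    using E'_subset by (auto simp: Field_def dest: E'_fst)
  moreover have c: "(b, hd c) \<in> E" "c \<noteq> []"
    using flower_Nbc by (cases c; simp add: flower_def)+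
  moreover have "fst (hd c) \<in> fst ` Field E" "fst (hd c) \<in> C"
    using FieldI2[OF c(1)] c(2) by (auto simp: C_def)
  ultimately have "fst ` Field E' \<subset> fst ` Field E" by blast
  then show "card (fst ` Field E') < card (fst ` Field E)"
    using assms by (intro psubset_card_mono finite_imageI finite_Field)
qed

lemma project_linkage:
  assumes "linkage E X T \<P>"
  obtains \<P>' where "linkage E' X T' \<P>'" "card \<P>' = card \<P>" "hd ` \<P>' = hd ` \<P>"
    "\<Union>(vs ` \<P>') \<subseteq> \<Union>(vs ` \<P>)"
proof -
  have "\<exists>q. link E' X T' q \<and> hd q = hd Z \<and> vs q \<subseteq> vs Z" if "Z \<in> \<P>" for Z
  proof -
    have "link E X T Z" using that assms by (simp add: linkage_def)
    then show ?thesis by (rule project) blast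
  qed
  then obtain f where f: "\<And>Z. Z \<in> \<P> \<Longrightarrow> link E' X T' (f Z) \<and> hd (f Z) = hd Z \<and> vs (f Z) \<subseteq> vs Z"
    by metis
  have "vs (f p) \<inter> vs (f q) = {}" if "p \<in> \<P>" "q \<in> \<P>" "p \<noteq> q" for p q
  proof -
    have "vs p \<inter> vs q = {}" using that assms by (simp add: linkage_def)
    then show ?thesis using f[OF that(1)] f[OF that(2)] by blast
  qed
  then have "linkage E' X T' (f ` \<P>)" "card (f ` \<P>) = card \<P>"
    using f linkage_image[of \<P> E' X T' f] assms by (auto simp: linkage_def)
  moreover have "hd ` f ` \<P> = hd ` \<P>"
    using f by (simp add: image_image cong: image_cong)
  moreover have "\<Union>(vs ` f ` \<P>) \<subseteq> \<Union>(vs ` \<P>)"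
    using f by blast
  ultimately show ?thesis by (rule that)
qed

text \<open>At most one path of the linkage visits the vertex of \<open>b\<close>, so at most one
  expands into the blossom and disjointness survives.\<close>

lemma lift_linkage:
  assumes "linkage E' X T' \<Q>"
  obtains \<Q>' where "linkage E X T \<Q>'" "card \<Q>' = card \<Q>" "hd ` \<Q>' = hd ` \<Q>"
proof -
  have "\<exists>p. link E X T p \<and> hd p = hd q \<and> vs p \<subseteq> vs q \<union> C \<and> (fst b \<notin> vs q \<longrightarrow> vs p \<subseteq> vs q)"
    if "q \<in> \<Q>" for q
  proof -
    have "link E' X T' q" using that assms by (simp add: linkage_def)
    then show ?thesis by (rule lift) blast
  qed
  then obtain f where f: "\<And>q. q \<in> \<Q> \<Longrightarrow> link E X T (f q) \<and> hd (f q) = hd q \<and> vs (f q) \<subseteq> vs q \<union> C \<and>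
      (fst b \<notin> vs q \<longrightarrow> vs (f q) \<subseteq> vs q)"
    by metis
  have qC: "vs q \<inter> C = {}" if "q \<in> \<Q>" for q
    using that assms link_E'_notin_C by (auto simp: linkage_def link_def)
  have "vs (f p) \<inter> vs (f q) = {}" if "p \<in> \<Q>" "q \<in> \<Q>" "p \<noteq> q" for p q
  proof -
    have "vs p \<inter> vs q = {}"
      using that assms by (auto simp: linkage_def)
    show ?thesis
    proof (rule disjoint_with_extra)
      show "vs (f p) \<subseteq> vs p \<and> vs (f q) \<subseteq> vs q \<union> C \<or> vs (f p) \<subseteq> vs p \<union> C \<and> vs (f q) \<subseteq> vs q"
        using f[OF that(1)] f[OF that(2)] \<open>vs p \<inter> vs q = {}\<close> by (metis IntI empty_iff)
    qed (fact qC[OF that(1)] qC[OF that(2)] \<open>vs p \<inter> vs q = {}\<close>)+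
  qed
  then have "linkage E X T (f ` \<Q>)" "card (f ` \<Q>) = card \<Q>"
    using f linkage_image[of \<Q> E X T f] assms by (auto simp: linkage_def)
  moreover have "hd ` f ` \<Q> = hd ` \<Q>"
    using f by (simp add: image_image cong: image_cong)
  ultimately show ?thesis by (rule that)
qed

lemma project_unseparated:
  assumes "unseparated E X T k"
  shows "unseparated E' X T' k"
  unfolding unseparated_def
proof (intro allI impI)
  fix S :: "'v set" assume "finite S \<and> card S = k"
  then obtain p where p: "link E X T p" "vs p \<inter> S = {}"
    using assms unfolding unseparated_def by metis
  obtain q where "link E' X T' q" "vs q \<subseteq> vs p"
    using project[OF p(1)] .
  moreover from this(2) have "vs q \<inter> S = {}"
    using p(2) by blast
  ultimately show "\<exists>p. link E' X T' p \<and> vs p \<inter> S = {}" by metis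
qed

end

section \<open>Enlarging the source set in the absence of flowers\<close>

context clean_skew
begin

text \<open>A later node is not in \<open>X\<close> because no arc enters \<open>X\<close>, and its
  flip is not in \<open>X\<close> by cleanness.\<close>

lemma avoids_X: "rpath E q \<Longrightarrow> hd q \<in> X \<Longrightarrow> vs (tl q) \<inter> fst ` X = {}"
proof (rule ccontr)
  assume q: "rpath E q" "hd q \<in> X" and "vs (tl q) \<inter> fst ` X \<noteq> {}"
  then obtain n x where n: "n \<in> set (tl q)" and x: "x \<in> X" "fst n = fst x" by auto
  then obtain q1 q2 where "tl q = q1 @ n # q2"
    by (meson split_list)
  moreover obtain a q' where "q = a # q'" using q by (cases q) (auto simp: rpath_def)
  ultimately have q_eq: "q = (a # q1) @ n # q2" by simp
  have "n \<notin> X"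
    using q(1) arcs_into[of E "a # q1" n q2] into_X by (auto simp: rpath_def q_eq)
  moreover have "flip n \<notin> X"
    using clean_prefix[of "a # q1" n q2] q by (simp add: q_eq)
  ultimately show False using x same_fst_cases[of n x] by auto
qed

lemma inj_on_X: "inj_on fst X"
proof (rule inj_onI)
  fix x y assume "x \<in> X" "y \<in> X" "fst x = fst y"
  moreover have "rpath E [y]" by (simp add: rpath_def)
  ultimately show "x = y"
    using same_fst_cases[of x y] clean_X[of "[y]"] by auto
qed

text \<open>Arcs into \<open>X'\<close> are deleted together with their mirror images, which
  preserves skew symmetry.\<close>

definition restrict :: "('v \<times> sign) set \<Rightarrow> (('v \<times> sign) \<times> ('v \<times> sign)) set" where
  "restrict X' = {(m, n) \<in> E. n \<notin> X' \<and> flip m \<notin> X'}"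

lemma arcs_restrict_iff:
  "arcs (restrict X') p \<longleftrightarrow> arcs E p \<and> set (tl p) \<inter> X' = {} \<and> flip ` set (butlast p) \<inter> X' = {}"
  by (induction p rule: induct_list012) (auto simp: restrict_def)

text \<open>Let \<open>D\<close> violate cleanness, running from \<open>n\<close> to
  \<open>m\<close> with \<open>n\<close> and \<open>flip m\<close> in \<open>X'\<close>, and let
  \<open>N\<close> lead to \<open>n\<close> inside \<open>X'\<close>. Since \<open>D\<close> avoids
  \<open>X'\<close> after its start and flips of \<open>X'\<close> before its end, it can meet
  \<open>N\<close> only in the vertex of \<open>m\<close>. If it does not, then both
  \<open>m\<close> and \<open>flip m\<close> are reachable from \<open>X\<close>, and the wrong-way
  fact gives a flower. If it does, \<open>N\<close> passes through \<open>flip m\<close>, and the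
  rest of \<open>N\<close> followed by \<open>D\<close> is a blossom based there.\<close>

lemma clean_skew_restrict:
  assumes "X \<subseteq> X'" and no_flower: "\<And>N b c. \<not> flower N b c"
    and reach: "\<And>n. n \<in> X' \<Longrightarrow> \<exists>N. rpath E (N @ [n]) \<and> hd (N @ [n]) \<in> X \<and> set N \<subseteq> X'"
  shows "clean_skew (restrict X') X'"
proof
  show "(flip n, flip m) \<in> restrict X'" if "(m, n) \<in> restrict X'" for m n
    using that by (auto simp: restrict_def intro: skew)
  show "n \<notin> X'" if "(m, n) \<in> restrict X'" for m n
    using that by (auto simp: restrict_def)
  have consistent: False if "rpath E N" "hd N \<in> X" "rpath E Z" "hd Z \<in> X" "n \<in> set N" "flip n \<in> set Z" for N Z n
    using flower_if_wrong_way[OF that] no_flower by metis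
  have flip_X': "flip n \<notin> X'" if n: "n \<in> X'" for n
  proof
    assume "flip n \<in> X'"
    then obtain N where "rpath E (N @ [flip n])" "hd (N @ [flip n]) \<in> X"
      using reach by blast
    moreover obtain Z where "rpath E (Z @ [n])" "hd (Z @ [n]) \<in> X"
      using reach[OF n] by blast
    ultimately show False using consistent[of "N @ [flip n]" "Z @ [n]" "flip n"] by simp
  qed
  show "flip (last D) \<notin> X'" if D: "rpath (restrict X') D" "hd D \<in> X'" for D
  proof
    assume m: "flip (last D) \<in> X'"
    define m where "m = last D"
    obtain n D' where D_eq: "D = n # D'" using D by (cases D) (auto simp: rpath_def)
    have "n \<in> X'" using D D_eq by simp
    then have "D' \<noteq> []" using m flip_X'[of n] D_eq by auto
    then obtain D1 where D1: "D = D1 @ [m]" "D1 \<noteq> []" "hd D1 = n"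
      using D_eq m_def by (metis append_butlast_last_id butlast.simps(2) list.sel(1) list.simps(3))
    have aD: "arcs E D" "set D' \<inter> X' = {}" "flip ` set D1 \<inter> X' = {}" and dD: "distinct (map fst D)"
      using D(1) D1(1) D_eq unfolding rpath_def arcs_restrict_iff by (metis butlast_snoc list.sel(3))+
    obtain N where N: "rpath E (N @ [n])" "hd (N @ [n]) \<in> X" "set N \<subseteq> X'"
      using reach[OF \<open>n \<in> X'\<close>] by blast
    obtain M where M: "rpath E (M @ [flip m])" "hd (M @ [flip m]) \<in> X"
      using reach m m_def by blast
    have D1N: "vs D1 \<inter> vs N = {}"
    proof (rule ccontr)
      assume "vs D1 \<inter> vs N \<noteq> {}"
      then obtain d e where de: "d \<in> set D1" "e \<in> set N" "fst d = fst e" by auto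
      then have "e \<noteq> flip d" using aD(3) N(3) by auto
      then have "e = d" using same_fst_cases[of e d] de by auto
      then have "d \<noteq> n" using N(1) de by (auto simp: rpath_def)
      then have "d \<in> set D'" using de D1 D_eq by (metis Un_iff set_ConsD set_append)
      then show False using aD(2) N(3) de \<open>e = d\<close> by auto
    qed
    show False
    proof (cases "fst m \<in> vs N")
      case False
      have "arcs E (N @ D)"
        using N(1) aD(1) arcs_join[of E N n D'] by (simp add: rpath_def D_eq)
      moreover have "distinct (map fst (N @ D))"
        using N(1) dD D1N False by (auto simp: rpath_def D1)
      moreover have "hd (N @ D) \<in> X" using N(2) D_eq by (cases N) auto
      ultimately have "rpath E (N @ D)" "hd (N @ D) \<in> X" by (auto simp: rpath_def D_eq)
      then show False
        using consistent[OF M, of "N @ D" "flip m"] by (simp add: D1)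
    next
      case True
      then obtain e where e: "e \<in> set N" "fst m = fst e" by auto
      have "m \<in> set D'" using m_def D_eq \<open>D' \<noteq> []\<close> by simp
      then have "e \<noteq> m" using aD(2) N(3) e by auto
      then have "flip m \<in> set N" using e same_fst_cases[of m e] by auto
      then obtain A A' where A: "N = A @ flip m # A'" by (meson split_list)
      obtain D1' where D1': "D1 = n # D1'" using D1 by (cases D1) auto
      have a: "arcs E (A @ [flip m])" "arcs E (flip m # A' @ [n])"
        using N(1) arcs_join[of E A "flip m" "A' @ [n]"] by (auto simp: rpath_def A)
      then have "arcs E (flip m # (A' @ D1) @ [flip (flip m)])"
        using aD(1) arcs_join[of E "flip m # A'" n "D1' @ [m]"] by (simp add: D1(1) D1')
      moreover have "distinct (map fst (A @ flip m # A' @ D1))"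
        using N(1) dD D1N by (auto simp: rpath_def D1 A)
      moreover have "hd (A @ [flip m]) \<in> X" using N(2) by (cases A) (auto simp: A)
      ultimately have "flower A (flip m) (A' @ D1)"
        using a D1(2) by (simp add: flower_def)
      then show False using no_flower by blast
    qed
  qed
qed

lemma rpath_restrict:
  assumes "rpath E q" "hd q \<in> X'" "vs (tl q) \<inter> fst ` X' = {}" "inj_on fst X'"
  shows "rpath (restrict X') q"
proof -
  have *: "n \<notin> X'" "flip n \<notin> X'" if "n \<in> set (tl q)" for n
    using that assms(3) by (metis IntI empty_iff fst_flip imageI)+
  obtain h t where q: "q = h # t" using assms(1) by (cases q) (auto simp: rpath_def)
  have "flip h \<notin> X'"
    using inj_onD[OF assms(4), of h "flip h"] assms(2) q by auto
  then have "flip ` set (butlast q) \<inter> X' = {}"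
    using * q by (auto dest: in_set_butlastD split: if_splits)
  then show ?thesis
    using assms(1) * by (auto simp: rpath_def arcs_restrict_iff)
qed

text \<open>Cut the path at its last node in \<open>X'\<close>. Should the remainder contain a node
  whose flip is in \<open>X'\<close>, its part up to the first such node would contradict cleanness
  of \<open>X'\<close>.\<close>

lemma link_restrict:
  assumes "X \<subseteq> X'" "clean_skew (restrict X') X'" "link E X T p"
  obtains p' where "link (restrict X') X' T p'" "vs p' \<subseteq> vs p"
proof -
  interpret r: clean_skew "restrict X'" X' by fact
  have p: "rpath E p" "hd p \<in> X" "last p \<in> T" "p \<noteq> []"
    using assms(3) by (auto simp: link_def rpath_def)
  then have "\<exists>n\<in>set p. n \<in> X'" using assms(1) hd_in_set by blast
  then obtain p1 n p2 where p_eq: "p = p1 @ n # p2" and n: "n \<in> X'" and p2: "\<forall>y\<in>set p2. y \<notin> X'"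
    using split_list_last_prop[of p "\<lambda>n. n \<in> X'"] by blast
  have np2: "arcs E (n # p2)" "distinct (map fst (n # p2))"
    using p(1) arcs_join[of E p1 n p2] by (auto simp: rpath_def p_eq)
  have "flip y \<notin> X'" if "y \<in> set (n # p2)" for y
  proof
    assume "flip y \<in> X'"
    then have "\<exists>y\<in>set (n # p2). flip y \<in> X'" using that by blast
    then obtain q1 y q2 where y: "n # p2 = q1 @ y # q2" "flip y \<in> X'" "\<forall>z\<in>set q1. flip z \<notin> X'"
      using split_list_first_prop[of "n # p2" "\<lambda>y. flip y \<in> X'"] by blast
    have "arcs E (q1 @ [y])" "distinct (map fst (q1 @ [y]))"
      using np2 arcs_join[of E q1 y q2] unfolding y(1) by auto
    moreover have "set (tl (q1 @ [y])) \<subseteq> set p2" "hd (q1 @ [y]) = n"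
      using y(1) by (cases q1; auto)+
    ultimately have "rpath (restrict X') (q1 @ [y])"
      using p2 y(3) by (auto simp: rpath_def arcs_restrict_iff)
    then show False
      using r.clean_X[of "q1 @ [y]"] y(2) n \<open>hd (q1 @ [y]) = n\<close> by simp
  qed
  then have "rpath (restrict X') (n # p2)"
    using np2 p2 by (auto simp: rpath_def arcs_restrict_iff dest: in_set_butlastD split: if_splits)
  then have "link (restrict X') X' T (n # p2)"
    using n p(3) by (auto simp: link_def p_eq)
  moreover have "vs (n # p2) \<subseteq> vs p" by (auto simp: p_eq)
  ultimately show ?thesis by (rule that)
qed

lemma unseparated_restrict:
  assumes "X \<subseteq> X'" "clean_skew (restrict X') X'" "unseparated E X T k"
  shows "unseparated (restrict X') X' T k"
  unfolding unseparated_def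
proof (intro allI impI)
  fix S :: "'v set" assume "finite S \<and> card S = k"
  then obtain p where p: "link E X T p" "vs p \<inter> S = {}"
    using assms(3) unfolding unseparated_def by metis
  obtain q where "link (restrict X') X' T q" "vs q \<subseteq> vs p"
    using link_restrict[OF assms(1,2) p(1)] .
  moreover from this(2) have "vs q \<inter> S = {}"
    using p(2) by blast
  ultimately show "\<exists>p. link (restrict X') X' T p \<and> vs p \<inter> S = {}" by metis
qed

text \<open>\<open>IH\<close> is applied after shortening \<open>P\<close> to \<open>p # P2\<close>.
  The new paths start at \<open>p\<close>, at the starts of the other old paths, and at one further
  node \<open>y\<close> of \<open>X'\<close>. If \<open>y\<close> lies on one of the segments
  \<open>P1\<close> and \<open>R1\<close>, the path at \<open>y\<close> is prolonged along that
  segment and the path at \<open>p\<close> along the other one; so they stay disjoint and one of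
  them starts where \<open>P\<close> did.\<close>

lemma augment_if_no_flower:
  assumes no_flower: "\<And>N b c. \<not> flower N b c"
    and \<P>: "linkage E X T \<P>" "unseparated E X T (card \<P>)"
    and P: "P \<in> \<P>" "P = P1 @ p # P2" "P1 \<noteq> []"
    and R: "rpath E (R1 @ [p])" "hd (R1 @ [p]) \<in> X" "\<And>q. q \<in> \<P> \<Longrightarrow> vs q \<inter> vs R1 = {}"
    and IH: "\<And>X' \<P>'. clean_skew (restrict X') X' \<Longrightarrow> linkage (restrict X') X' T \<P>' \<Longrightarrow>
      unseparated (restrict X') X' T (card \<P>') \<Longrightarrow> \<Union>(vs ` \<P>') \<subset> \<Union>(vs ` \<P>) \<Longrightarrow>
      \<exists>\<Q>. linkage (restrict X') X' T \<Q> \<and> card \<Q> = Suc (card \<P>') \<and> hd ` \<P>' \<subseteq> hd ` \<Q>"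
  shows "\<exists>\<Q>. linkage E X T \<Q> \<and> card \<Q> = Suc (card \<P>) \<and> hd ` \<P> \<subseteq> hd ` \<Q>"
proof -
  define X' where "X' = X \<union> set P1 \<union> set R1 \<union> {p}"
  have fin: "finite \<P>" and links: "\<And>q. q \<in> \<P> \<Longrightarrow> rpath E q \<and> hd q \<in> X \<and> last q \<in> T \<and> q \<noteq> []"
    and disj: "\<And>q r. q \<in> \<P> \<Longrightarrow> r \<in> \<P> \<Longrightarrow> q \<noteq> r \<Longrightarrow> vs q \<inter> vs r = {}"
    using \<P>(1) by (auto simp: linkage_def link_def rpath_def)
  have P1p: "rpath E (P1 @ [p])" "hd (P1 @ [p]) \<in> X" "hd P1 \<in> X" "hd P = hd P1"
    using links[OF P(1)] arcs_join[of E P1 p P2] P(2,3) by (auto simp: rpath_def)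
  have dP: "distinct (map fst (P1 @ p # P2))" and aP: "arcs E (p # P2)"
    using links[OF P(1)] P(2) arcs_join[of E P1 p P2] by (auto simp: rpath_def)
  have dR: "distinct (map fst (R1 @ [p]))"
    using R(1) by (simp add: rpath_def)
  have PR: "vs P1 \<inter> vs R1 = {}"
    using R(3)[OF P(1)] P(2) by auto
  have reach: "\<exists>N. rpath E (N @ [n]) \<and> hd (N @ [n]) \<in> X \<and> set N \<subseteq> X'" if n: "n \<in> X'" for n
  proof -
    have prefix: ?thesis if L: "rpath E (L @ [p])" "hd (L @ [p]) \<in> X" "set L \<subseteq> X'" "n \<in> set (L @ [p])" for L
    proof -
      obtain A B where AB: "L @ [p] = A @ n # B" using L(4) by (meson split_list)
      have "rpath E (A @ [n])"
        using L(1) arcs_join[of E A n B] unfolding rpath_def AB by auto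
      moreover have "hd (A @ [n]) \<in> X" using L(2) unfolding AB by (cases A) auto
      moreover have "set A \<subseteq> set L" using AB by (cases B rule: rev_cases) auto
      ultimately show ?thesis using L(3) by blast
    qed
    consider "n \<in> X" | "n \<in> set (P1 @ [p])" | "n \<in> set (R1 @ [p])"
      using n by (auto simp: X'_def)
    then show ?thesis
    proof cases
      case 1
      then show ?thesis by (intro exI[of _ "[]"]) (auto simp: rpath_def)
    next
      case 2
      then show ?thesis using prefix P1p by (auto simp: X'_def)
    next
      case 3
      then show ?thesis using prefix R by (auto simp: X'_def)
    qed
  qed
  have XX': "X \<subseteq> X'" by (auto simp: X'_def)
  have cl: "clean_skew (restrict X') X'"
    using XX' no_flower reach by (rule clean_skew_restrict)
  interpret r: clean_skew "restrict X'" X' by fact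
  have fstX': "fst ` X' = fst ` X \<union> vs P1 \<union> vs R1 \<union> {fst p}"
    by (auto simp: X'_def image_Un)
  define \<P>' where "\<P>' = insert (p # P2) (\<P> - {P})"
  have pP2: "vs (p # P2) \<subseteq> vs P" "fst p \<in> vs P" "vs P1 \<subseteq> vs P"
    using P(2) by auto
  have other: "vs q \<inter> vs P = {}" "vs q \<inter> vs R1 = {}" "vs (tl q) \<subseteq> vs q" if "q \<in> \<P> - {P}" for q
    using disj[of q P] R(3)[of q] P(1) that by (simp, simp, cases q, auto)
  have otherp: "vs q \<inter> vs (p # P2) = {}" if "q \<in> \<P> - {P}" for q
    using disjoint_subsets[OF other(1)[OF that] order_refl pP2(1)] .
  have "link (restrict X') X' T q" if q: "q \<in> \<P>'" for q
  proof (cases "q = p # P2")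
    case True
    have "vs P2 \<inter> fst ` X = {}"
      using avoids_X[of P] links[OF P(1)] P(2,3) by (cases P1) (auto simp: image_Un Int_Un_distrib2)
    moreover have "vs P2 \<inter> vs R1 = {}" "vs P2 \<inter> (vs P1 \<union> {fst p}) = {}"
      using R(3)[OF P(1)] dP P(2) by auto
    ultimately have "vs (tl q) \<inter> fst ` X' = {}"
      using True fstX' by auto
    moreover have "rpath E q" "hd q \<in> X'" "last q \<in> T"
      using True aP dP links[OF P(1)] P(2) by (auto simp: rpath_def X'_def)
    ultimately show ?thesis
      using rpath_restrict[OF _ _ _ r.inj_on_X] by (simp add: link_def)
  next
    case False
    then have q': "q \<in> \<P> - {P}" using q by (auto simp: \<P>'_def)
    then have *: "rpath E q" "hd q \<in> X" "last q \<in> T" using links by auto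
    have "vs (tl q) \<inter> vs P1 = {}" "vs (tl q) \<inter> {fst p} = {}" "vs (tl q) \<inter> vs R1 = {}"
      using disjoint_subsets[OF other(1)[OF q'] other(3)[OF q']]
        disjoint_subsets[OF other(2)[OF q'] other(3)[OF q']] pP2 by auto
    then have "vs (tl q) \<inter> fst ` X' = {}"
      using avoids_X[OF *(1,2)] by (simp add: fstX' Int_Un_distrib)
    then show ?thesis
      using rpath_restrict[OF *(1) _ _ r.inj_on_X] * XX' by (auto simp: link_def)
  qed
  moreover have "vs q \<inter> vs q' = {}" if "q \<in> \<P>'" "q' \<in> \<P>'" "q \<noteq> q'" for q q'
    using that disj[of q q'] otherp[of q] otherp[of q'] unfolding \<P>'_def by (metis Diff_iff Int_commute insertE)
  ultimately have \<P>': "linkage (restrict X') X' T \<P>'"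
    using fin by (auto simp: linkage_def \<P>'_def)
  have "p # P2 \<notin> \<P> - {P}"
    using otherp[of "p # P2"] by auto
  then have card: "card \<P>' = card \<P>"
    using fin card_Suc_Diff1[OF fin P(1)] by (simp add: \<P>'_def)
  have hd\<P>': "hd ` \<P>' = insert p (hd ` (\<P> - {P}))"
    by (simp add: \<P>'_def)
  \<comment> \<open>Shortening \<open>P\<close> loses its start, because
    \<open>P1 \<noteq> []\<close>; this is the strict decrease that \<open>IH\<close> asks
    for.\<close>
  have "fst (hd P) \<in> \<Union>(vs ` \<P>)"
    using P(1) links[OF P(1)] by (metis UN_I hd_in_set imageI)
  moreover have "\<Union>(vs ` \<P>') \<subseteq> \<Union>(vs ` \<P>)"
  proof (rule UN_least)
    fix q assume "q \<in> \<P>'"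
    then have "\<exists>r\<in>\<P>. vs q \<subseteq> vs r" using P(1) pP2(1) by (auto simp only: \<P>'_def)
    then show "vs q \<subseteq> \<Union>(vs ` \<P>)" by (metis UN_upper order_trans)
  qed
  moreover have "fst (hd P) \<notin> \<Union>(vs ` \<P>')"
  proof -
    have "fst (hd P) \<in> vs P" using links[OF P(1)] by auto
    moreover have "fst (hd P) \<notin> vs (p # P2)" using dP P(2,3) by (cases P1) auto
    moreover have "fst (hd P) \<notin> vs q" if "q \<in> \<P> - {P}" for q
      using other(1)[OF that] \<open>fst (hd P) \<in> vs P\<close> by (meson disjoint_iff)
    ultimately show ?thesis unfolding \<P>'_def by (metis UN_E insertE)
  qed
  ultimately have "\<Union>(vs ` \<P>') \<subset> \<Union>(vs ` \<P>)" by (metis psubsetI)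
  moreover have "unseparated (restrict X') X' T (card \<P>')"
    using unseparated_restrict[OF XX' cl \<P>(2)] card by simp
  ultimately obtain \<Q> where \<Q>: "linkage (restrict X') X' T \<Q>" "card \<Q> = Suc (card \<P>)" "hd ` \<P>' \<subseteq> hd ` \<Q>"
    using IH[OF cl \<P>'] card by auto
  have links\<Q>: "rpath (restrict X') q" "hd q \<in> X'" "last q \<in> T" "q \<noteq> []" if "q \<in> \<Q>" for q
    using \<Q>(1) that by (auto simp: linkage_def link_def rpath_def)
  have inj: "inj_on hd \<Q>" and fin\<Q>: "finite \<Q>"
    using linkage_inj_hd[OF \<Q>(1)] \<Q>(1) by (auto simp: linkage_def)
  have "card (hd ` \<Q> - hd ` \<P>') = 1"
    using \<Q> fin\<Q> card card_image[OF inj] card_image[OF linkage_inj_hd[OF \<P>']]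
    by (subst card_Diff_subset) (auto intro: finite_subset[of "hd ` \<P>'" "hd ` \<Q>"])
  then obtain y where y: "hd ` \<Q> - hd ` \<P>' = {y}"
    by (rule card_1_singletonE)
  then have "y \<in> hd ` \<Q>" and y_notin: "y \<notin> hd ` \<P>'"
    and y_unique: "\<And>x. x \<in> hd ` \<Q> \<Longrightarrow> x \<noteq> y \<Longrightarrow> x \<in> hd ` \<P>'"
    by (metis Diff_iff singletonI singletonD)+
  then obtain N where N: "N \<in> \<Q>" "hd N = y" by (metis imageE)
  obtain Q where Q: "Q \<in> \<Q>" "hd Q = p" using \<Q>(3) hd\<P>' by auto
  have "y \<noteq> p" using y_notin hd\<P>' by auto
  have hd_other: "fst (hd q) \<notin> vs P1 \<union> vs R1" if "q \<in> \<Q> - {N, Q}" for q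
  proof -
    have "hd q \<noteq> y" "hd q \<noteq> p"
      using that inj_onD[OF inj, of q N] inj_onD[OF inj, of q Q] N Q by auto
    then have "hd q \<in> hd ` (\<P> - {P})"
      using that y_unique[of "hd q"] hd\<P>' by (metis DiffD1 imageI insertE)
    then obtain r where r: "r \<in> \<P> - {P}" "hd q = hd r" by (metis imageE)
    then have "fst (hd q) \<in> vs r" using links[of r] by auto
    then have "fst (hd q) \<notin> vs P" "fst (hd q) \<notin> vs R1"
      using other(1,2)[OF r(1)] by (meson disjoint_iff)+
    then show ?thesis using pP2(3) by (meson UnE subsetD)
  qed
  \<comment> \<open>\<open>\<alpha>\<close> is to be put before the path at \<open>y\<close>, and
    \<open>\<beta>\<close> before the path at \<open>p\<close>.\<close>
  obtain \<alpha> \<beta> where \<alpha>: "rpath E (\<alpha> @ [y])" "hd (\<alpha> @ [y]) \<in> X" and \<beta>: "rpath E (\<beta> @ [p])" "hd (\<beta> @ [p]) \<in> X"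
    and \<alpha>\<beta>: "set \<alpha> \<union> set \<beta> \<subseteq> set P1 \<union> set R1" "set \<alpha> \<inter> set \<beta> = {}" "y \<notin> set \<beta>" "p \<notin> set \<alpha>"
    and start: "hd P1 = hd (\<alpha> @ [y]) \<or> hd P1 = hd (\<beta> @ [p])"
  proof -
    have PR_nodes: "set P1 \<inter> set R1 = {}" "p \<notin> set P1" "p \<notin> set R1"
      using PR dP dR by auto
    have "y \<in> X'" using links\<Q> N by auto
    then consider "y \<in> set P1" | "y \<in> set R1" | "y \<in> X" "y \<notin> set P1 \<union> set R1"
      using \<open>y \<noteq> p\<close> by (auto simp: X'_def)
    then show ?thesis
    proof cases
      case 1
      then obtain A B where AB: "P1 = A @ y # B" by (meson split_list)
      have "rpath E (A @ [y])" "hd (A @ [y]) \<in> X" "hd P1 = hd (A @ [y])"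
        using P1p arcs_join[of E A y "B @ [p]"] unfolding rpath_def AB by (auto simp: hd_append)
      then show ?thesis
        using that[of A R1] R(1,2) PR_nodes 1 AB by auto
    next
      case 2
      then obtain A B where AB: "R1 = A @ y # B" by (meson split_list)
      have "rpath E (A @ [y])" "hd (A @ [y]) \<in> X"
        using R(1,2) arcs_join[of E A y "B @ [p]"] unfolding rpath_def AB by (auto simp: hd_append)
      then show ?thesis
        using that[of A P1] P1p PR_nodes 2 AB P(3) by auto
    next
      \<comment> \<open>Here \<open>y\<close> already lies in the old \<open>X\<close>, so the path
        at \<open>p\<close> takes \<open>P1\<close> and thereby keeps the start of
        \<open>P\<close>.\<close>
      case 3
      then show ?thesis
        using that[of "[]" P1] P1p P(3) by (auto simp: rpath_def)
    qed
  qed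
  define f where "f q = (if q = N then \<alpha> else if q = Q then \<beta> else []) @ q" for q
  have "N \<noteq> Q" using N Q \<open>y \<noteq> p\<close> by auto
  have extend: "link E X T (\<gamma> @ q)"
    if "q \<in> \<Q>" "rpath E (\<gamma> @ [hd q])" "hd (\<gamma> @ [hd q]) \<in> X" "set \<gamma> \<subseteq> X'" for \<gamma> q
  proof -
    have q: "q = hd q # tl q" "arcs E q" "distinct (map fst q)" "vs (tl q) \<inter> fst ` X' = {}"
      using links\<Q>[OF that(1)] r.avoids_X[of q] by (auto simp: rpath_def arcs_restrict_iff)
    have "vs \<gamma> \<inter> vs (tl q) = {}"
      using disjoint_subsets[OF q(4) order_refl image_mono[OF that(4)]] by (simp add: Int_commute)
    moreover have "distinct (map fst (hd q # tl q))" using q(1,3) by simp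
    ultimately have "distinct (map fst (\<gamma> @ hd q # tl q))"
      using that(2) by (auto simp: rpath_def)
    moreover have "arcs E (\<gamma> @ hd q # tl q)"
      using that(2) q(1,2) arcs_join[of E \<gamma> "hd q" "tl q"] by (simp add: rpath_def)
    ultimately have "rpath E (\<gamma> @ q)"
      using q(1) links\<Q>(4)[OF that(1)] by (simp add: rpath_def)
    moreover have "hd (\<gamma> @ q) \<in> X" using that(3) by (cases \<gamma>) auto
    ultimately show ?thesis
      using links\<Q>[OF that(1)] by (simp add: link_def)
  qed
  have extend_disjoint: "vs (\<gamma> @ q) \<inter> vs (\<delta> @ q') = {}"
    if "q \<in> \<Q>" "q' \<in> \<Q>" "q \<noteq> q'" "set \<gamma> \<subseteq> X'" "set \<delta> \<subseteq> X'" "set \<gamma> \<inter> set \<delta> = {}"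
      "hd q \<notin> set \<delta>" "hd q' \<notin> set \<gamma>" for \<gamma> \<delta> q q'
  proof -
    \<comment> \<open>After its start \<open>q\<close> avoids the vertices of \<open>X'\<close>, and
      \<open>fst\<close> is injective on \<open>X'\<close>; so only the start of \<open>q\<close>
      can clash with a prefix.\<close>
    have *: "vs \<eta> \<inter> vs q = {}" if "q \<in> \<Q>" "set \<eta> \<subseteq> X'" "hd q \<notin> set \<eta>" for \<eta> q
    proof -
      have "set q = insert (hd q) (set (tl q))"
        using links\<Q>(4)[OF that(1)] by (cases q) auto
      moreover have "vs (tl q) \<inter> fst ` X' = {}"
        using links\<Q>[OF that(1)] r.avoids_X[of q] by simp
      moreover have "fst (hd q) \<notin> vs \<eta>"
        using inj_on_image_mem_iff[OF r.inj_on_X] links\<Q>(2)[OF that(1)] that by metis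
      ultimately show ?thesis
        using disjoint_subsets[of "vs (tl q)" "fst ` X'" "vs (tl q)" "vs \<eta>"] image_mono[OF that(2), of fst]
        by (simp add: Int_commute)
    qed
    have "vs \<gamma> \<inter> vs \<delta> = {}"
      using inj_on_image_Int[OF r.inj_on_X that(4,5)] that(6) by simp
    moreover have "vs q \<inter> vs q' = {}"
      using \<Q>(1) that by (auto simp: linkage_def)
    ultimately show ?thesis
      using *[OF that(1,5,7)] *[OF that(2,4,8)]
      by (simp add: image_Un Int_Un_distrib Int_Un_distrib2 Int_commute)
  qed
  have sub: "set \<alpha> \<subseteq> X'" "set \<beta> \<subseteq> X'" using \<alpha>\<beta>(1) by (auto simp: X'_def)
  have hd_other': "hd q \<notin> set \<alpha>" "hd q \<notin> set \<beta>" if "q \<in> \<Q>" "q \<noteq> N" "q \<noteq> Q" for q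
    using hd_other[of q] that \<alpha>\<beta>(1) by auto
  have hd_\<alpha>: "hd q \<notin> set \<alpha>" if "q \<in> \<Q>" "q \<noteq> N" for q
    using hd_other'(1)[of q] that Q \<alpha>\<beta>(4) by (cases "q = Q") auto
  have hd_\<beta>: "hd q \<notin> set \<beta>" if "q \<in> \<Q>" "q \<noteq> Q" for q
    using hd_other'(2)[of q] that N \<alpha>\<beta>(3) by (cases "q = N") auto
  have "link E X T (f q)" if "q \<in> \<Q>" for q
  proof -
    consider "q = N" | "q = Q" | "q \<noteq> N" "q \<noteq> Q" by blast
    then show ?thesis
    proof cases
      case 1
      then show ?thesis using extend[of N \<alpha>] N \<alpha> sub by (simp add: f_def)
    next
      case 2
      then show ?thesis using extend[of Q \<beta>] Q \<beta> sub \<open>N \<noteq> Q\<close> by (simp add: f_def)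
    next
      case 3
      then have "hd q \<noteq> y" "hd q \<noteq> p"
        using that inj_onD[OF inj, of q N] inj_onD[OF inj, of q Q] N Q by auto
      then have "hd q \<in> hd ` (\<P> - {P})"
      using that y_unique[of "hd q"] hd\<P>' by (metis DiffD1 imageI insertE)
      then have "hd q \<in> X" using links by auto
      then show ?thesis using 3 extend[of q "[]"] that by (simp add: f_def rpath_def)
    qed
  qed
  moreover have "vs (f q) \<inter> vs (f q') = {}" if "q \<in> \<Q>" "q' \<in> \<Q>" "q \<noteq> q'" for q q'
    unfolding f_def
    by (rule extend_disjoint) (use that sub \<alpha>\<beta>(2) hd_\<alpha> hd_\<beta> \<open>N \<noteq> Q\<close> in auto)
  ultimately have "linkage E X T (f ` \<Q>)" "card (f ` \<Q>) = card \<Q>"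
    using linkage_image[of \<Q> E X T f] fin\<Q> by auto
  moreover have "hd ` \<P> \<subseteq> hd ` f ` \<Q>"
  proof
    fix x assume "x \<in> hd ` \<P>"
    then obtain r where r: "r \<in> \<P>" "x = hd r" by blast
    show "x \<in> hd ` f ` \<Q>"
    proof (cases "r = P")
      case True
      have "hd (f N) = hd (\<alpha> @ [y])" "hd (f Q) = hd (\<beta> @ [p])"
        using N Q \<open>N \<noteq> Q\<close> by (auto simp: f_def hd_append)
      then have "x = hd (f N) \<or> x = hd (f Q)" using start P1p(4) r True by auto
      then show ?thesis using N Q by blast
    next
      case False
      then have "x \<in> hd ` \<P>'" using r hd\<P>' by blast
      then obtain q where q: "q \<in> \<Q>" "x = hd q" using \<Q>(3) by blast
      have "x \<noteq> y" using \<open>x \<in> hd ` \<P>'\<close> y_notin by blast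
      moreover have "fst x \<in> vs r" using r links by auto
      then have "x \<noteq> p" using other(1)[of r] r(1) False pP2(2) by (meson DiffI disjoint_iff singletonD)
      ultimately have "f q = q" using q N Q by (auto simp: f_def)
      then show ?thesis using q by force
    qed
  qed
  ultimately show ?thesis using \<Q>(2) by metis
qed

end

section \<open>The induction\<close>

text \<open>Contraction lowers the number of vertices of the digraph and adds none to the paths;
  enlarging \<open>X\<close> only deletes arcs and lowers the number of vertices on the paths. Hence
  the sum of the two as measure. \<open>T\<close> has to vary as well, since contraction replaces it
  by \<open>T'\<close>.\<close>

theorem linkage_augment:
  assumes "clean_skew E X" "finite E" "linkage E X T \<P>" "unseparated E X T (card \<P>)"
  shows "\<exists>\<Q>. linkage E X T \<Q> \<and> card \<Q> = Suc (card \<P>) \<and> hd ` \<P> \<subseteq> hd ` \<Q>"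
  using assms
proof (induction "card (fst ` Field E) + card (\<Union>(vs ` \<P>))" arbitrary: E X T \<P> rule: less_induct)
  case less
  interpret clean_skew E X by fact
  have fin: "finite \<P>" and links: "\<And>q. q \<in> \<P> \<Longrightarrow> rpath E q \<and> hd q \<in> X \<and> last q \<in> T \<and> q \<noteq> []"
    using less.prems(3) by (auto simp: linkage_def link_def rpath_def)
  then have finU: "finite (\<Union>(vs ` \<P>))" by simp
  show ?case
  proof (cases "\<exists>N b c. flower N b c")
    case True
    then have "\<exists>F. case F of (N, b, c) \<Rightarrow> flower N b c" by auto
    from ex_has_least_nat[of "\<lambda>(N, b, c). flower N b c" _ "\<lambda>(N, b, c). length N"] this
    obtain N b c where "flower N b c" and "\<And>N' b' c'. flower N' b' c' \<Longrightarrow> length N \<le> length N'"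
      by fast
    then interpret contraction E X N b c T
      by unfold_locales
    obtain \<P>' where \<P>': "linkage E' X T' \<P>'" "card \<P>' = card \<P>" "hd ` \<P>' = hd ` \<P>"
      "\<Union>(vs ` \<P>') \<subseteq> \<Union>(vs ` \<P>)"
      using project_linkage[OF less.prems(3)] .
    have "card (fst ` Field E') + card (\<Union>(vs ` \<P>')) < card (fst ` Field E) + card (\<Union>(vs ` \<P>))"
      using card_E'(2)[OF less.prems(2)] card_mono[OF finU \<P>'(4)] by simp
    then obtain \<Q> where \<Q>: "linkage E' X T' \<Q>" "card \<Q> = Suc (card \<P>)" "hd ` \<P> \<subseteq> hd ` \<Q>"
      using less.hyps[OF _ clean_skew_E' card_E'(1)[OF less.prems(2)] \<P>'(1)]
        project_unseparated[OF less.prems(4)] \<P>'(2,3) by auto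
    then show ?thesis
      using lift_linkage[OF \<Q>(1)] by metis
  next
    case False
    have IH: "\<exists>\<Q>. linkage (restrict X') X' T \<Q> \<and> card \<Q> = Suc (card \<P>') \<and> hd ` \<P>' \<subseteq> hd ` \<Q>"
      if "clean_skew (restrict X') X'" "linkage (restrict X') X' T \<P>'"
        "unseparated (restrict X') X' T (card \<P>')" "\<Union>(vs ` \<P>') \<subset> \<Union>(vs ` \<P>)" for X' \<P>'
    proof -
      have sub: "restrict X' \<subseteq> E" by (auto simp: restrict_def)
      then have "card (fst ` Field (restrict X')) \<le> card (fst ` Field E)"
        using less.prems(2) by (intro card_mono image_mono mono_Field finite_imageI finite_Field)
      then show ?thesis
        using less.hyps[OF _ that(1) finite_subset[OF sub less.prems(2)] that(2,3)]
          psubset_card_mono[OF finU that(4)] by simp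
    qed
    \<comment> \<open>The starts lie on distinct vertices, so \<open>A\<close> has exactly the size
      for which \<open>unseparated\<close> supplies a path \<open>R\<close> avoiding it.\<close>
    define A where "A = (\<lambda>q. fst (hd q)) ` \<P>"
    have "inj_on (\<lambda>q. fst (hd q)) \<P>"
      using comp_inj_on[OF linkage_inj_hd[OF less.prems(3)], of fst] inj_on_subset[OF inj_on_X, of "hd ` \<P>"] links
      by (simp add: comp_def image_subset_iff)
    then have "finite A" "card A = card \<P>"
      using fin by (auto simp: A_def card_image)
    then obtain R where R: "link E X T R" and RA: "vs R \<inter> A = {}"
      using less.prems(4) unfolding unseparated_def by metis
    then have R': "rpath E R" "hd R \<in> X" "R \<noteq> []" by (auto simp: link_def rpath_def)
    show ?thesis
    proof (cases "\<exists>r\<in>set R. fst r \<in> \<Union>(vs ` \<P>)")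
      case False
      then have disj: "vs R \<inter> vs q = {}" if "q \<in> \<P>" for q using that by auto
      then have "R \<notin> \<P>" using R'(3) by fastforce
      moreover have "linkage E X T (insert R \<P>)"
        using less.prems(3) R disj unfolding linkage_def by (metis Int_commute finite_insert insertE)
      ultimately show ?thesis
        using fin by (intro exI[of _ "insert R \<P>"]) auto
    next
      case True
      then obtain R1 r R2 where R_eq: "R = R1 @ r # R2" and r: "fst r \<in> \<Union>(vs ` \<P>)"
        and R1: "\<forall>y\<in>set R1. fst y \<notin> \<Union>(vs ` \<P>)"
        using split_list_first_prop[of R "\<lambda>r. fst r \<in> \<Union>(vs ` \<P>)"] by blast
      from r obtain P p where P: "P \<in> \<P>" "p \<in> set P" "fst r = fst p" by auto
      \<comment> \<open>Otherwise \<open>P\<close> and \<open>R\<close> pass this vertex in opposite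
        directions and give a flower.\<close>
      have "flip p \<notin> set R"
        using flower_if_wrong_way[of P R p] links[OF P(1)] R' P(2) False by metis
      then have "r = p" using same_fst_cases[OF P(3)] R_eq by auto
      obtain P1 P2 where P_eq: "P = P1 @ p # P2" using P(2) by (meson split_list)
      have "fst p \<notin> A" using RA \<open>r = p\<close> R_eq by auto
      then have "P1 \<noteq> []" using imageI[OF P(1), of "\<lambda>q. fst (hd q)"] P_eq by (auto simp: A_def)
      have R1p: "rpath E (R1 @ [p])" "hd (R1 @ [p]) \<in> X"
        using R' arcs_join[of E R1 p R2] by (auto simp: rpath_def R_eq \<open>r = p\<close> hd_append)
      have R1_disj: "vs q \<inter> vs R1 = {}" if "q \<in> \<P>" for q
        using R1 that by force
      have no_flower: "\<not> flower N b c" for N b c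
        using \<open>\<not> (\<exists>N b c. flower N b c)\<close> by blast
      show ?thesis
        by (rule augment_if_no_flower[OF no_flower less.prems(3,4) P(1) P_eq \<open>P1 \<noteq> []\<close> R1p R1_disj IH])
    qed
  qed
qed

section \<open>Translation between bidirected graphs and skew-symmetric digraphs\<close>

text \<open>\<open>F\<close> bounds the vertices of the digraph, so that it is finite even if
  \<open>B\<close> is not.\<close>

locale bidirected_linkage = bidirected_graph B for B :: "('v, 'e) bigraph" +
  fixes X Y :: "('v \<times> sign) set" and F :: "'v set"
  assumes X_signed: "X \<subseteq> signed_verts B" and clean: "clean B X" and finite_F: "finite F"
begin

text \<open>At a vertex of \<open>X\<close> with both signs all edges may be given the same sign, since \<open>X\<close>--\<open>Y\<close> paths can only start
  there. So \<open>D\<close>, \<open>sg\<close> and \<open>X0\<close> reduce to the case that every vertex carries at most one sign in \<open>X\<close>.\<close>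

definition D :: "'v set" where
  "D = {v. (v, Plus) \<in> X \<and> (v, Minus) \<in> X}"

definition sg :: "'v \<Rightarrow> 'e \<Rightarrow> sign" where
  "sg v e = (if v \<in> D then Plus else signing B v e)"

definition X0 :: "('v \<times> sign) set" where
  "X0 = {(v, a) \<in> X. v \<in> D \<longrightarrow> a = Plus}"

text \<open>A node records the sign of departure, so a path ending at \<open>(v, a)\<close> arrives
  with sign \<open>opposite a\<close>. At a vertex of \<open>D\<close> either sign in
  \<open>Y\<close> produces a trivial path.\<close>

definition T0 :: "('v \<times> sign) set" where
  "T0 = {(v, a). if v \<in> D then v \<in> verts_of Y else (v, opposite a) \<in> Y}"

text \<open>An internal vertex of an \<open>X\<close>--\<open>Y\<close> path may not lie in \<open>V(Y)\<close> even if it is passed with signs that do not allow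
  the path to stop there; \<open>leave\<close> removes the arcs that would make this possible.\<close>

definition leave :: "'v \<times> sign \<Rightarrow> bool" where
  "leave m \<longleftrightarrow> flip m \<notin> X0 \<and> (m \<in> T0 \<longrightarrow> flip m \<in> T0)"

definition joins :: "'e \<Rightarrow> 'v \<times> sign \<Rightarrow> 'v \<times> sign \<Rightarrow> bool" where
  "joins e m n \<longleftrightarrow> e \<in> edges B \<and> ends B e = {fst m, fst n} \<and>
     snd m = sg (fst m) e \<and> snd n = opposite (sg (fst n) e)"

text \<open>Flipping an arc exchanges the two conditions on \<open>leave\<close>, so the digraph is
  skew-symmetric.\<close>

definition A :: "(('v \<times> sign) \<times> ('v \<times> sign)) set" where
  "A = {(m, n). leave m \<and> leave (flip n) \<and> fst m \<in> F \<and> fst n \<in> F \<and> (\<exists>e. joins e m n)}"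

lemma joins_flip: "joins e m n \<Longrightarrow> joins e (flip n) (flip m)"
  by (auto simp: joins_def flip_def)

lemma sign_cases: "(v, a) \<in> X \<Longrightarrow> (v, b) \<in> X \<Longrightarrow> a \<noteq> b \<Longrightarrow> v \<in> D"
  by (cases a; cases b) (auto simp: D_def)

lemma D_X: "v \<in> D \<Longrightarrow> (v, a) \<in> X"
  by (cases a) (auto simp: D_def)

lemma X0_flip: "m \<in> X0 \<Longrightarrow> flip m \<notin> X0"
  using sign_cases[of "fst m" "snd m" "opposite (snd m)"] by (cases m) (auto simp: X0_def flip_def)

text \<open>Trivial \<open>X\<close>--\<open>Y\<close> paths thus correspond to links with a single
  node.\<close>

lemma X0_iff_trivial: "m \<in> X0 \<Longrightarrow> m \<in> T0 \<longleftrightarrow> forms_trivial_walk X Y (fst m)"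
proof
  assume m: "m \<in> X0" "m \<in> T0"
  obtain v a where ma: "m = (v, a)" by (cases m)
  show "forms_trivial_walk X Y (fst m)"
  proof (cases "v \<in> D")
    case True
    then obtain c where "(v, c) \<in> Y" using m by (auto simp: T0_def ma verts_of_def)
    then show ?thesis
      using D_X[OF True, of "opposite c"] unfolding forms_trivial_walk_def ma
      by (intro exI[of _ "opposite c"]) simp
  next
    case False
    then show ?thesis using m by (auto simp: T0_def X0_def ma forms_trivial_walk_def)
  qed
next
  assume m: "m \<in> X0" and "forms_trivial_walk X Y (fst m)"
  then obtain c where c: "(fst m, c) \<in> X" "(fst m, opposite c) \<in> Y"
    by (auto simp: forms_trivial_walk_def)
  then show "m \<in> T0"
    using m sign_cases[of "fst m" c "snd m"] by (cases m) (auto simp: T0_def X0_def verts_of_def)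
qed

lemma verts_of_X_cases: "fst m \<in> verts_of X \<Longrightarrow> m \<in> X0 \<or> flip m \<in> X0"
proof -
  assume "fst m \<in> verts_of X"
  then obtain c where c: "(fst m, c) \<in> X" by (auto simp: verts_of_def)
  define n where "n = (fst m, if fst m \<in> D then Plus else c)"
  have "n \<in> X0" using c D_X by (auto simp: n_def X0_def)
  then show ?thesis using same_fst_cases[of n m] by (auto simp: n_def)
qed

lemma verts_of_Y_cases: "fst m \<in> verts_of Y \<Longrightarrow> m \<in> T0 \<or> flip m \<in> T0"
proof -
  assume "fst m \<in> verts_of Y"
  then obtain c where c: "(fst m, c) \<in> Y" by (auto simp: verts_of_def)
  define n where "n = (fst m, opposite c)"
  have "n \<in> T0" using c by (auto simp: n_def T0_def verts_of_def)
  then show ?thesis using same_fst_cases[of n m] by (auto simp: n_def)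
qed

lemma leave_internal: "fst m \<notin> verts_of X \<Longrightarrow> fst m \<notin> verts_of Y \<Longrightarrow> leave m"
  by (cases m) (auto simp: leave_def flip_def X0_def T0_def verts_of_def split: if_splits)

lemma leave_start: "m \<in> X0 \<Longrightarrow> \<not> forms_trivial_walk X Y (fst m) \<Longrightarrow> leave m"
  using X0_flip X0_iff_trivial[of m] by (auto simp: leave_def)

lemma leave_end: "m \<in> T0 \<Longrightarrow> \<not> forms_trivial_walk X Y (fst m) \<Longrightarrow> leave (flip m)"
  using X0_iff_trivial[of m] by (auto simp: leave_def)

lemma finite_A: "finite A"
proof (rule finite_subset)
  show "A \<subseteq> (F \<times> UNIV) \<times> (F \<times> UNIV)"
    by (auto simp: A_def)
  have "(UNIV :: sign set) = {Plus, Minus}"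
    by (auto intro: sign.exhaust)
  then have "finite (UNIV :: sign set)"
    by (metis finite.emptyI finite_insert)
  then show "finite ((F \<times> (UNIV :: sign set)) \<times> (F \<times> (UNIV :: sign set)))"
    using finite_F by (intro finite_cartesian_product)
qed

lemma walk_of_rpath:
  assumes p: "rpath A p" "hd p \<in> X0"
  obtains W where "is_path B W" "walk_verts W = map fst p" "walk_length W = length p - 1"
    "\<forall>i. Suc i < length p \<longrightarrow> joins (walk_edges W ! i) (p ! i) (p ! Suc i)"
proof -
  define edge where "edge m n = (SOME e. joins e m n)" for m n
  have edge: "joins (edge m n) m n" if "(m, n) \<in> A" for m n
    using that someI_ex[of "\<lambda>e. joins e m n"] by (auto simp: A_def edge_def)
  define es where "es = map (\<lambda>i. edge (p ! i) (p ! Suc i)) [0..<length p - 1]"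
  define W where "W = (fst (hd p), zip es (map fst (tl p)))"
  have ne: "p \<noteq> []" and arcs: "\<And>i. Suc i < length p \<Longrightarrow> (p ! i, p ! Suc i) \<in> A" and dist: "distinct (map fst p)"
    using p(1) by (auto simp: rpath_def successively_conv_nth)
  have les: "length es = length p - 1" by (simp add: es_def)
  have wv: "walk_verts W = map fst p"
    using ne les by (cases p) (auto simp: walk_verts_def W_def)
  have we: "walk_edges W = es"
    using les by (simp add: walk_edges_def W_def)
  have j: "joins (es ! i) (p ! i) (p ! Suc i)" if "Suc i < length p" for i
    using edge[OF arcs[OF that]] that nth_map_upt[of i "length p - 1" 0] by (simp add: es_def less_diff_conv)
  have e: "es ! i \<in> edges B" "ends B (es ! i) = {fst (p ! i), fst (p ! Suc i)}" if "Suc i < length p" for i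
    using j[OF that] by (auto simp: joins_def)
  have nth: "map fst p ! i = fst (p ! i)" if "i < length p" for i
    using that by simp
  have "fst (p ! i) \<in> verts B" if "i < length p" for i
  proof (cases i)
    case 0
    then show ?thesis
      using p(2) ne X_signed by (auto simp: hd_conv_nth X0_def signed_verts_def)
  next
    case (Suc i')
    then show ?thesis using e[of i'] ends_subset[of "es ! i'"] that by auto
  qed
  then have vB: "set (map fst p) \<subseteq> verts B"
    by (auto simp: in_set_conv_nth simp del: fst_conv split_paired_All) (metis fst_conv)
  have eB: "set es \<subseteq> edges B"
    using e les by (auto simp: in_set_conv_nth)
  have signs: "signing B (fst (p ! Suc i)) (es ! i) \<noteq> signing B (fst (p ! Suc i)) (es ! Suc i)"
    if "Suc (Suc i) < length p" for i
  proof -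
    \<comment> \<open>As \<open>sg\<close> is constant at a vertex of \<open>D\<close>, this
      equation excludes internal vertices in \<open>D\<close>; at all others \<open>sg\<close> is
      the original signing.\<close>
    have "opposite (sg (fst (p ! Suc i)) (es ! i)) = sg (fst (p ! Suc i)) (es ! Suc i)"
      using j[of i] j[of "Suc i"] that by (simp add: joins_def)
    then show ?thesis by (auto simp: sg_def split: if_splits)
  qed
  have "is_walk B W"
    unfolding is_walk_def walk_length_def wv we les
    using vB eB e signs by auto
  \<comment> \<open>Equal edges would have equal pairs of ends, which is impossible for different
    steps along distinct vertices.\<close>
  moreover have "distinct es"
  proof (subst distinct_conv_nth, intro allI impI)
    fix i k assume ik: "i < length es" "k < length es" "i \<noteq> k"
    show "es ! i \<noteq> es ! k"
    proof
      assume "es ! i = es ! k"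
      then have "{fst (p ! i), fst (p ! Suc i)} = {fst (p ! k), fst (p ! Suc k)}"
        using e[of i] e[of k] ik les by auto
      moreover have "fst (p ! a) = fst (p ! b) \<longleftrightarrow> a = b" if "a < length p" "b < length p" for a b
        using nth_eq_iff_index_eq[OF dist, of a b] that by simp
      ultimately show False using ik les by (auto simp: doubleton_eq_iff)
    qed
  qed
  ultimately have "is_path B W"
    using dist by (simp add: is_path_def is_trail_def wv we)
  then show ?thesis
    using that[of W] wv we les j by (simp add: walk_length_def)
qed

text \<open>At a vertex of \<open>D\<close> the digraph has forgotten the sign of the edge, hence
  the alternatives.\<close>

lemma signed_ends:
  assumes "walk_verts W = map fst p" "walk_length W = length p - 1" "length p > 1"
    and j: "\<forall>i. Suc i < length p \<longrightarrow> joins (walk_edges W ! i) (p ! i) (p ! Suc i)"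
  shows "fst (start_signed B W) = fst (hd p)" "fst (hd p) \<in> D \<or> start_signed B W = hd p"
    "fst (end_signed B W) = fst (last p)" "fst (last p) \<in> D \<or> end_signed B W = flip (last p)"
proof -
  have ne: "p \<noteq> []" "walk_edges W \<noteq> []" using assms(2,3) by (auto simp: walk_length_def)
  obtain l where l: "length p = Suc (Suc l)" using assms(3) by (metis One_nat_def less_imp_Suc_add add_Suc)
  have hd: "hd (walk_edges W) = walk_edges W ! 0" "hd p = p ! 0" "last p = p ! Suc l"
    "last (walk_edges W) = walk_edges W ! l"
    using ne assms(2) l by (auto simp: hd_conv_nth last_conv_nth walk_length_def)
  show s: "fst (start_signed B W) = fst (hd p)" "fst (end_signed B W) = fst (last p)"
    using ne assms(1) by (auto simp: start_signed_def start_vertex_def end_signed_def end_vertex_def hd_map last_map)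
  show "fst (hd p) \<in> D \<or> start_signed B W = hd p"
    using j[rule_format, of 0] s l hd by (auto simp: joins_def sg_def start_signed_def prod_eq_iff split: if_splits)
  show "fst (last p) \<in> D \<or> end_signed B W = flip (last p)"
    using j[rule_format, of l] s l hd by (auto simp: joins_def sg_def end_signed_def prod_eq_iff flip_def split: if_splits)
qed

lemma X0_D: "m \<in> X0 \<Longrightarrow> fst s = fst m \<Longrightarrow> fst m \<in> D \<or> s = m \<Longrightarrow> s \<in> X"
  by (cases s; cases m) (auto simp: X0_def D_X)

lemma clean_skew_A: "clean_skew A X0"
proof
  show "(flip n, flip m) \<in> A" if "(m, n) \<in> A" for m n
    using that by (auto simp: A_def intro: joins_flip)
  show "n \<notin> X0" if "(m, n) \<in> A" for m n
    using that by (auto simp: A_def leave_def)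
  show "flip (last p) \<notin> X0" if p: "rpath A p" "hd p \<in> X0" for p
  proof
    assume l: "flip (last p) \<in> X0"
    \<comment> \<open>Cleanness of \<open>B\<close> speaks about nontrivial paths only; a single
      node is handled by \<open>X0\<close> having at most one sign at each vertex.\<close>
    have "length p \<noteq> 1"
    proof
      assume "length p = 1"
      then have "last p = hd p" by (cases p) auto
      then show False using l p X0_flip by auto
    qed
    moreover have "p \<noteq> []" using p by (simp add: rpath_def)
    ultimately have len: "length p > 1" by (cases p) auto
    obtain W where W: "is_path B W" "walk_verts W = map fst p" "walk_length W = length p - 1"
      "\<forall>i. Suc i < length p \<longrightarrow> joins (walk_edges W ! i) (p ! i) (p ! Suc i)"
      using walk_of_rpath[OF p] .
    note s = signed_ends[OF W(2,3) len W(4)]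
    have "start_signed B W \<in> X" using X0_D[OF p(2) s(1,2)] .
    moreover have "end_signed B W \<in> X" using X0_D[OF l] s(3,4) by simp
    moreover have "\<not> trivial W" using W(3) len by (simp add: trivial_def)
    ultimately show False using clean W(1) unfolding clean_def by metis
  qed
qed

text \<open>A link may run past a target, so it is cut at its first node in \<open>T0\<close>. By
  \<open>leave\<close>, a node that is entered and whose vertex lies in \<open>V(Y)\<close> belongs
  to \<open>T0\<close> itself; hence no such vertex is internal to the cut path.\<close>

lemma XY_path_of_link:
  assumes "link A X0 T0 p"
  obtains W where "is_XY_path B X Y W" "set (walk_verts W) \<subseteq> vs p" "start_vertex W = fst (hd p)"
proof -
  interpret clean_skew A X0 by (rule clean_skew_A)
  have p: "rpath A p" "hd p \<in> X0" "last p \<in> T0" "p \<noteq> []"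
    using assms by (auto simp: link_def rpath_def)
  then have "\<exists>t\<in>set p. t \<in> T0" using last_in_set by blast
  then obtain p1 t p2 where p_eq: "p = p1 @ t # p2" and t: "t \<in> T0" and p1: "\<forall>m\<in>set p1. m \<notin> T0"
    using split_list_first_prop[of p "\<lambda>t. t \<in> T0"] by blast
  define q where "q = p1 @ [t]"
  have q: "rpath A q" "hd q \<in> X0" "hd q = hd p"
    using p arcs_join[of A p1 t p2] by (auto simp: rpath_def p_eq q_def hd_append)
  obtain W where W: "is_path B W" "walk_verts W = map fst q" "walk_length W = length q - 1"
    "\<forall>i. Suc i < length q \<longrightarrow> joins (walk_edges W ! i) (q ! i) (q ! Suc i)"
    using walk_of_rpath[OF q(1,2)] .
  have start: "start_vertex W = fst (hd p)" and fin: "end_vertex W = fst t"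
    using W(2) q(3) hd_map[of q fst] by (auto simp: start_vertex_def end_vertex_def q_def)
  have "is_XY_walk B X Y W"
  proof (cases "p1 = []")
    case True
    then have "trivial W" using W(3) by (simp add: trivial_def q_def)
    moreover have "forms_trivial_walk X Y (start_vertex W)"
      using X0_iff_trivial[OF p(2)] True t start by (simp add: p_eq)
    ultimately show ?thesis using W(1) by (simp add: is_XY_walk_def is_path_def is_trail_def)
  next
    case False
    then have len: "length q > 1" by (cases p1) (auto simp: q_def)
    note s = signed_ends[OF W(2,3) len W(4)]
    have "last q = t" by (simp add: q_def)
    \<comment> \<open>So the end lies outside \<open>V(X)\<close>: it forms no trivial path, and as
      it is not in \<open>D\<close>, its sign in \<open>B\<close> can be read off from
      \<open>t\<close>.\<close>
    have tX: "t \<notin> X0" "flip t \<notin> X0"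
      using False q arcs_into[of A p1 t "[]"] into_X clean_X[of q] by (auto simp: q_def rpath_def)
    then have tV: "fst t \<notin> verts_of X" using verts_of_X_cases by blast
    then have "fst t \<notin> D" using D_X by (auto simp: verts_of_def)
    then have "end_signed B W \<in> Y"
      using s(4) t \<open>last q = t\<close> by (cases t) (auto simp: T0_def flip_def)
    moreover have "start_signed B W \<in> X" using X0_D[OF q(2) s(1,2)] .
    moreover have "\<not> forms_trivial_walk X Y (end_vertex W)"
      using tV fin by (auto simp: forms_trivial_walk_def verts_of_def)
    moreover have "hd q \<notin> T0" using p1 False by (cases p1) (auto simp: q_def)
    then have "\<not> forms_trivial_walk X Y (start_vertex W)"
      using X0_iff_trivial[OF q(2)] start q(3) by simp
    moreover have "internal_verts W \<inter> (verts_of X \<union> verts_of Y) = {}"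
    proof -
      have "fst (q ! i) \<notin> verts_of X \<union> verts_of Y" if i: "1 \<le> i" "Suc i < length q" for i
      proof -
        have "q ! i = p1 ! i" "i < length p1" using i by (auto simp: q_def nth_append)
        then have "q ! i \<notin> T0" using p1 by simp
        have arc: "(q ! k, q ! Suc k) \<in> A" if "Suc k < length q" for k
          using q(1) that by (simp add: rpath_def successively_conv_nth)
        have "(q ! (i - 1), q ! i) \<in> A" "(q ! i, q ! Suc i) \<in> A"
          using arc[of "i - 1"] arc[of i] i by simp_all
        then have "leave (flip (q ! i))" "leave (q ! i)" by (auto simp: A_def)
        then have "q ! i \<notin> X0" "flip (q ! i) \<notin> X0" "flip (q ! i) \<notin> T0"
          using \<open>q ! i \<notin> T0\<close> by (auto simp: leave_def)
        then show ?thesis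
          using \<open>q ! i \<notin> T0\<close> verts_of_X_cases verts_of_Y_cases by blast
      qed
      then show ?thesis
        using W(2,3) by (auto simp: internal_verts_def)
    qed
    moreover have "\<not> trivial W" using W(3) len by (simp add: trivial_def)
    ultimately show ?thesis using W(1) by (simp add: is_XY_walk_def is_path_def is_trail_def)
  qed
  then have "is_XY_path B X Y W" using W(1) by (simp add: is_XY_path_def)
  moreover have "set (walk_verts W) \<subseteq> vs p" using W(2) by (auto simp: q_def p_eq)
  ultimately show ?thesis using start by (rule that)
qed

lemma link_of_XY_path:
  assumes W: "is_XY_path B X Y W" and WF: "set (walk_verts W) \<subseteq> F"
  obtains p where "link A X0 T0 p" "map fst p = walk_verts W"
proof (cases "trivial W")
  case True
  define v where "v = start_vertex W"
  have "forms_trivial_walk X Y v" using W True by (simp add: is_XY_path_def is_XY_walk_def v_def)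
  then obtain a where a: "(v, a) \<in> X" "(v, opposite a) \<in> Y" by (auto simp: forms_trivial_walk_def)
  define m where "m = (v, if v \<in> D then Plus else a)"
  have "m \<in> X0" "m \<in> T0" using a D_X by (auto simp: m_def X0_def T0_def verts_of_def)
  then have "link A X0 T0 [m]" by (simp add: link_def rpath_def)
  moreover have "walk_verts W = [v]"
    using True by (auto simp: trivial_def walk_length_def walk_edges_def walk_verts_def v_def start_vertex_def)
  ultimately show ?thesis using that by (simp add: m_def)
next
  case False
  define vl where "vl = walk_verts W"
  define es where "es = walk_edges W"
  define l where "l = length es"
  have lv: "length vl = Suc l" by (simp add: vl_def l_def es_def walk_verts_def walk_edges_def)
  have "l > 0" using False by (simp add: trivial_def walk_length_def l_def es_def)
  have w: "\<And>i. i < l \<Longrightarrow> es ! i \<in> edges B" "\<And>i. i < l \<Longrightarrow> ends B (es ! i) = {vl ! i, vl ! Suc i}"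
    "\<And>i. Suc i < l \<Longrightarrow> signing B (vl ! Suc i) (es ! i) \<noteq> signing B (vl ! Suc i) (es ! Suc i)"
    "distinct vl"
    using W by (auto simp: is_XY_path_def is_path_def is_trail_def is_walk_def walk_length_def vl_def es_def l_def)
  have xy: "start_signed B W \<in> X" "end_signed B W \<in> Y"
    "internal_verts W \<inter> (verts_of X \<union> verts_of Y) = {}"
    "\<not> forms_trivial_walk X Y (vl ! 0)" "\<not> forms_trivial_walk X Y (vl ! l)"
    using W False lv by (auto simp: is_XY_path_def is_XY_walk_def start_vertex_def end_vertex_def vl_def hd_conv_nth last_conv_nth
        simp flip: length_greater_0_conv)
  have "vl \<noteq> []" "es \<noteq> []" using lv \<open>l > 0\<close> by (auto simp: l_def)
  then have start: "(vl ! 0, signing B (vl ! 0) (es ! 0)) \<in> X"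
    using xy(1) lv \<open>l > 0\<close> hd_conv_nth[of vl] hd_conv_nth[of es]
    by (auto simp: start_signed_def start_vertex_def vl_def[symmetric] es_def[symmetric] l_def)
  from \<open>vl \<noteq> []\<close> \<open>es \<noteq> []\<close> have fin: "(vl ! l, signing B (vl ! l) (es ! (l - 1))) \<in> Y"
    using xy(2) lv \<open>l > 0\<close> last_conv_nth[of vl] last_conv_nth[of es]
    by (auto simp: end_signed_def end_vertex_def vl_def[symmetric] es_def[symmetric] l_def)
  have internal: "vl ! i \<notin> verts_of X" "vl ! i \<notin> verts_of Y" if "0 < i" "i < l" for i
  proof -
    have "vl ! i \<in> internal_verts W"
      using that by (auto simp: internal_verts_def walk_length_def vl_def l_def es_def)
    then show "vl ! i \<notin> verts_of X" "vl ! i \<notin> verts_of Y" using xy(3) by auto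
  qed
  \<comment> \<open>Each vertex gets the sign of the edge by which it is left; the last one has no
    such edge and gets the opposite of its arrival sign.\<close>
  define node where "node i = (vl ! i, if i < l then sg (vl ! i) (es ! i) else opposite (sg (vl ! i) (es ! (i - 1))))" for i
  have start0: "node 0 \<in> X0"
    using start \<open>l > 0\<close> D_X by (auto simp: node_def X0_def sg_def)
  have finT: "node l \<in> T0"
    using fin \<open>l > 0\<close> by (auto simp: node_def T0_def sg_def verts_of_def)
  have leave_node: "leave (node i)" if "i < l" for i
    using that leave_internal[of "node i"] internal[of i] leave_start[OF start0] xy(4)
    by (cases i) (auto simp: node_def)
  have leave_flip: "leave (flip (node i))" if "0 < i" "i \<le> l" for i
  proof (cases "i = l")
    case True
    then show ?thesis using leave_end[OF finT] xy(5) by (simp add: node_def)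
  next
    case False
    then show ?thesis
      using that internal[of i] by (intro leave_internal) (auto simp: node_def)
  qed
  have arc: "(node i, node (Suc i)) \<in> A" if "i < l" for i
  proof -
    \<comment> \<open>At an internal vertex the change of sign along the walk must not be erased by
      \<open>sg\<close>.\<close>
    have "vl ! Suc i \<notin> D" if "Suc i < l"
      using internal(1)[of "Suc i"] that D_X by (auto simp: verts_of_def)
    then have "joins (es ! i) (node i) (node (Suc i))"
      using that w(1,2)[OF that] w(3)[of i] by (auto simp: joins_def node_def sg_def eq_opposite_iff)
    moreover have "vl ! i \<in> F" "vl ! Suc i \<in> F"
      using WF that lv by (auto simp: vl_def[symmetric])
    ultimately show ?thesis
      using leave_node[OF that] leave_flip[of "Suc i"] that by (auto simp: A_def) (auto simp: node_def)
  qed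
  define p where "p = map node [0..<Suc l]"
  have mp: "map fst p = vl"
    by (rule nth_equalityI) (auto simp: p_def lv node_def simp del: upt_Suc)
  have "arcs A p"
    using arc by (auto simp: successively_conv_nth p_def simp del: upt_Suc)
  then have "rpath A p"
    using mp w(4) by (auto simp: rpath_def p_def)
  moreover have "hd p = node 0" "last p = node l"
    by (auto simp: p_def hd_map last_map simp del: upt_Suc)
  ultimately have "link A X0 T0 p" using start0 finT by (simp add: link_def)
  then show ?thesis using that mp by (simp add: vl_def)
qed

end

section \<open>Vertex deletion and the dichotomy\<close>

lemma length_walk_verts: "length (walk_verts W) = Suc (length (walk_edges W))"
  by (simp add: walk_verts_def walk_edges_def)

lemma is_walk_delete_verts:
  "is_walk (delete_verts B S) W \<longleftrightarrow> is_walk B W \<and> set (walk_verts W) \<inter> S = {}"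
proof -
  have "ends B e \<inter> S = {}"
    if e: "e \<in> set (walk_edges W)" "set (walk_verts W) \<inter> S = {}"
      "\<forall>i<length (walk_edges W). ends B (walk_edges W ! i) = {walk_verts W ! i, walk_verts W ! Suc i}" for e
  proof -
    obtain i where i: "i < length (walk_edges W)" "e = walk_edges W ! i"
      using e(1) by (auto simp: in_set_conv_nth)
    then have "walk_verts W ! i \<in> set (walk_verts W)" "walk_verts W ! Suc i \<in> set (walk_verts W)"
      using length_walk_verts[of W] by (auto intro: nth_mem)
    then show ?thesis using e(2,3) i by auto
  qed
  then show ?thesis
    by (auto simp: is_walk_def delete_verts_def walk_length_def)
qed

lemma is_XY_path_delete_verts:
  "is_XY_path (delete_verts B S) X Y W \<longleftrightarrow> is_XY_path B X Y W \<and> set (walk_verts W) \<inter> S = {}"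
proof -
  have "start_signed (delete_verts B S) W = start_signed B W" "end_signed (delete_verts B S) W = end_signed B W"
    by (simp_all add: start_signed_def end_signed_def delete_verts_def)
  then show ?thesis
    by (auto simp: is_XY_path_def is_XY_walk_def is_path_def is_trail_def is_walk_delete_verts)
qed

text \<open>Choosing an element of \<open>S\<close> in each \<open>V i\<close> is injective, and
  exhausts \<open>S\<close> if the cardinalities agree.\<close>

lemma transversal:
  assumes "finite I" "finite S" "\<And>i. i \<in> I \<Longrightarrow> V i \<inter> S \<noteq> {}"
    and disj: "\<And>i j. i \<in> I \<Longrightarrow> j \<in> I \<Longrightarrow> i \<noteq> j \<Longrightarrow> V i \<inter> V j = {}"
  shows "card I \<le> card S" "card S = card I \<Longrightarrow> S \<subseteq> (\<Union>i\<in>I. V i)"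
proof -
  have "\<exists>s. s \<in> V i \<inter> S" if "i \<in> I" for i
    using assms(3)[OF that] by blast
  then obtain s where s: "\<And>i. i \<in> I \<Longrightarrow> s i \<in> V i \<inter> S" by metis
  have inj: "inj_on s I"
    using s disj by (intro inj_onI) (metis IntE IntI empty_iff)
  have sub: "s ` I \<subseteq> S" using s by blast
  show "card I \<le> card S"
    using card_inj_on_le[OF inj sub assms(2)] .
  show "S \<subseteq> (\<Union>i\<in>I. V i)" if "card S = card I"
  proof -
    have "s ` I = S"
      using sub that card_image[OF inj] assms(2) by (intro card_subset_eq) auto
    then show ?thesis using s by blast
  qed
qed

theorem theorem1p2:
  fixes B :: "('v, 'e) bigraph"
    and X Y :: "('v \<times> sign) set"
    and k :: nat
    and P :: "nat \<Rightarrow> ('v, 'e) walk"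
    and v :: "nat \<Rightarrow> 'v"
  assumes "bidirected_graph B"
    and "X \<subseteq> signed_verts B"
    and "Y \<subseteq> signed_verts B"
    and "clean B X"
    and "\<And>i. i \<in> {1..k} \<Longrightarrow> is_XY_path B X Y (P i)"
    and "pairwise (\<lambda>i j. vertex_disjoint (P i) (P j)) {1..k}"
    and "\<And>i. i \<in> {1..k} \<Longrightarrow> v i \<in> verts_of X \<and> start_vertex (P i) = v i"
  shows "(\<exists>S. S \<subseteq> verts B \<and> finite S \<and> card S = k \<and>
            \<not> (\<exists>Q. is_XY_path (delete_verts B S) X Y Q))
       \<noteq> (\<exists>P'. (\<forall>i \<in> {1..k+1}. is_XY_path B X Y (P' i)) \<and>
            pairwise (\<lambda>i j. vertex_disjoint (P' i) (P' j)) {1..k+1} \<and>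
            (\<forall>i \<in> {1..k}. start_vertex (P' i) = v i))"
    (is "?sep \<noteq> ?paths")
proof -
  have "\<not> (?sep \<and> ?paths)"
  proof
    assume "?sep \<and> ?paths"
    then obtain S P' where S: "finite S" "card S = k" "\<not> (\<exists>Q. is_XY_path (delete_verts B S) X Y Q)"
      and P': "\<forall>i \<in> {1..k+1}. is_XY_path B X Y (P' i)"
        "pairwise (\<lambda>i j. vertex_disjoint (P' i) (P' j)) {1..k+1}"
      by blast
    have "card {1..k+1} \<le> card S"
    proof (rule transversal(1))
      show "set (walk_verts (P' i)) \<inter> S \<noteq> {}" if "i \<in> {1..k+1}" for i
        using S(3) P'(1) that unfolding is_XY_path_delete_verts by metis
      show "set (walk_verts (P' i)) \<inter> set (walk_verts (P' j)) = {}"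
        if "i \<in> {1..k+1}" "j \<in> {1..k+1}" "i \<noteq> j" for i j
        using pairwiseD[OF P'(2) that] by (simp add: vertex_disjoint_def)
    qed (use S in auto)
    then show False using S(2) by simp
  qed
  moreover have ?paths if "\<not> ?sep"
  proof -
    define N where "N = (\<Union>i\<in>{1..k}. set (walk_verts (P i)))"
    have "finite N" by (simp add: N_def)
    have "N \<subseteq> verts B"
      using assms(5) by (force simp: N_def is_XY_path_def is_XY_walk_def is_walk_def)
    have "\<exists>Q. is_XY_path (delete_verts B S) X Y Q" if "S \<subseteq> N" "card S = k" for S
    proof (rule ccontr)
      assume "\<not> ?thesis"
      then have ?sep
        using that \<open>N \<subseteq> verts B\<close> finite_subset[OF that(1) \<open>finite N\<close>] by (intro exI[of _ S]) simp
      then show False using \<open>\<not> ?sep\<close> by contradiction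
    qed
    then obtain Z where Z: "\<And>S. S \<subseteq> N \<Longrightarrow> card S = k \<Longrightarrow> is_XY_path (delete_verts B S) X Y (Z S)"
      by metis
    \<comment> \<open>\<open>N\<close> has only finitely many subsets of size \<open>k\<close>, so
      adding one avoiding path for each of them keeps \<open>F\<close> finite.\<close>
    define F where "F = N \<union> (\<Union>S\<in>{S. S \<subseteq> N \<and> card S = k}. set (walk_verts (Z S)))"
    have "finite F"
      using \<open>finite N\<close> by (simp add: F_def)
    interpret bidirected_linkage B X Y F
      using assms(1,2,4) \<open>finite F\<close> by (simp add: bidirected_linkage_def bidirected_linkage_axioms_def)
    have "\<exists>p. link A X0 T0 p \<and> map fst p = walk_verts (P i)" if "i \<in> {1..k}" for i
    proof -
      have "set (walk_verts (P i)) \<subseteq> F" using that by (auto simp: F_def N_def)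
      then show ?thesis using link_of_XY_path[OF assms(5)[OF that]] by metis
    qed
    then obtain p where p: "\<And>i. i \<in> {1..k} \<Longrightarrow> link A X0 T0 (p i)"
      and pv: "\<And>i. i \<in> {1..k} \<Longrightarrow> map fst (p i) = walk_verts (P i)"
      by metis
    have vsp: "vs (p i) = set (walk_verts (P i))" if "i \<in> {1..k}" for i
      using pv[OF that] by (metis set_map)
    have disj: "vs (p i) \<inter> vs (p j) = {}" if "i \<in> {1..k}" "j \<in> {1..k}" "i \<noteq> j" for i j
      using pairwiseD[OF assms(6) that] that by (simp add: vertex_disjoint_def vsp del: atLeastAtMost_iff)
    have linkage: "linkage A X0 T0 (p ` {1..k})" and card: "card (p ` {1..k}) = k"
      using linkage_image[of "{1..k}" A X0 T0 p] p disj by auto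
    have "unseparated A X0 T0 k"
      unfolding unseparated_def
    proof (intro allI impI)
      fix S :: "'v set" assume S: "finite S \<and> card S = k"
      show "\<exists>p. link A X0 T0 p \<and> vs p \<inter> S = {}"
      \<comment> \<open>Either a given path avoids \<open>S\<close>, or \<open>S\<close> is a
        transversal of all \<open>k\<close> of them; then \<open>S\<close> is contained in
        \<open>N\<close> and \<open>Z S\<close> avoids it.\<close>
      proof (cases "\<exists>i\<in>{1..k}. vs (p i) \<inter> S = {}")
        case True
        then show ?thesis using p by metis
      next
        case False
        then have "S \<subseteq> (\<Union>i\<in>{1..k}. vs (p i))"
          using transversal(2)[of "{1..k}" S "\<lambda>i. vs (p i)"] S disj by simp
        then have "S \<subseteq> N" using vsp by (simp add: N_def)
        then have *: "is_XY_path B X Y (Z S)" "set (walk_verts (Z S)) \<inter> S = {}"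
          using Z S by (auto simp: is_XY_path_delete_verts)
        have "set (walk_verts (Z S)) \<subseteq> F" using \<open>S \<subseteq> N\<close> S by (auto simp: F_def)
        then obtain z where "link A X0 T0 z" "map fst z = walk_verts (Z S)"
          using link_of_XY_path[OF *(1)] by metis
        then show ?thesis using *(2) by (metis set_map)
      qed
    qed
    then obtain \<Q> where \<Q>: "linkage A X0 T0 \<Q>" "card \<Q> = Suc k" "hd ` p ` {1..k} \<subseteq> hd ` \<Q>"
      using linkage_augment[OF clean_skew_A finite_A linkage] card by auto
    have "\<exists>q\<in>\<Q>. hd q = hd (p i)" if "i \<in> {1..k}" for i
      using \<Q>(3) that by (metis image_eqI image_iff subsetD)
    then obtain q where q: "\<And>i. i \<in> {1..k} \<Longrightarrow> q i \<in> \<Q>" "\<And>i. i \<in> {1..k} \<Longrightarrow> hd (q i) = hd (p i)"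
      by metis
    have hd_p: "hd (p i) \<noteq> hd (p j)" if "i \<in> {1..k}" "j \<in> {1..k}" "i \<noteq> j" for i j
    proof -
      have "fst (hd (p i)) \<in> vs (p i)" "fst (hd (p j)) \<in> vs (p j)"
        using p that by (auto simp: link_def rpath_def)
      then show ?thesis using disj[OF that] by (metis IntI empty_iff)
    qed
    have "card (q ` {1..k}) \<le> k" using card_image_le[of "{1..k}" q] by simp
    then have "\<not> \<Q> \<subseteq> q ` {1..k}"
      using card_mono[of "q ` {1..k}" \<Q>] \<Q>(2) by auto
    then obtain r where r: "r \<in> \<Q>" "r \<notin> q ` {1..k}" by blast
    \<comment> \<open>The index \<open>k+1\<close> receives the extra path \<open>r\<close>.\<close>
    define Q where "Q i = (if i \<in> {1..k} then q i else r)" for i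
    have QQ: "Q i \<in> \<Q>" for i using q(1) r(1) by (simp add: Q_def del: atLeastAtMost_iff)
    have Q_ne: "Q i \<noteq> Q j" if ij: "i \<in> {1..k+1}" "j \<in> {1..k+1}" "i \<noteq> j" for i j
    proof -
      consider "i \<in> {1..k}" "j \<in> {1..k}" | "i \<in> {1..k}" "j \<notin> {1..k}" | "i \<notin> {1..k}" "j \<in> {1..k}"
        using ij by force
      then show ?thesis
        by cases (use r(2) hd_p[OF _ _ ij(3)] q(2) in \<open>metis Q_def imageI\<close>)+
    qed
    have "\<exists>W. is_XY_path B X Y W \<and> set (walk_verts W) \<subseteq> vs (Q i) \<and> start_vertex W = fst (hd (Q i))" for i
    proof -
      have "link A X0 T0 (Q i)" using \<Q>(1) QQ by (simp add: linkage_def)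
      then show ?thesis using XY_path_of_link by metis
    qed
    then obtain P' where P': "\<And>i. is_XY_path B X Y (P' i)" "\<And>i. set (walk_verts (P' i)) \<subseteq> vs (Q i)"
      "\<And>i. start_vertex (P' i) = fst (hd (Q i))"
      by metis
    have "vertex_disjoint (P' i) (P' j)" if "i \<in> {1..k+1}" "j \<in> {1..k+1}" "i \<noteq> j" for i j
    proof -
      have "vs (Q i) \<inter> vs (Q j) = {}"
        using \<Q>(1) QQ Q_ne[OF that] by (simp add: linkage_def)
      then show ?thesis
        unfolding vertex_disjoint_def by (rule disjoint_subsets) (rule P'(2))+
    qed
    moreover have "start_vertex (P' i) = v i" if "i \<in> {1..k}" for i
    proof -
      have "p i \<noteq> []" using p[OF that] by (simp add: link_def rpath_def)
      then have "fst (hd (p i)) = start_vertex (P i)"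
        using pv[OF that] hd_map[of "p i" fst] by (simp add: start_vertex_def)
      then show ?thesis
        using P'(3)[of i] q(2)[OF that] assms(7)[OF that] that by (simp add: Q_def)
    qed
    ultimately show ?thesis
      using P'(1) by (intro exI[of _ P']) (simp add: pairwise_def)
  qed
  ultimately show ?thesis by blast
qed

end
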